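(* For every quantum channel $\mathcal{N}\colon A\to B$, $$\eta_{\mathrm{MI}}(\mathcal{N})=\eta^{p}_D(\mathcal{N}).$$
   Context: All systems are finite-dimensional. A channel on $A$ acts as the identity on other systems. $D(\rho\|\sigma)=\operatorname{Tr}[\rho(\log\rho-\log\sigma)]$ if $\operatorname{supp}(\rho)\subseteq\operatorname{supp}(\sigma)$, else $+\infty$; $I(A:B)=D(\rho_{AB}\|\rho_A\otimes\rho_B)$. In every ratio optimization, the supremum is over states for which the denominator is strictly positive and finite (coefficient $0$ if there are none). $$\eta_{\mathrm{MI}}(\mathcal{N})=\sup_{C,\ \rho_{CA}}\frac{I(C:B)}{I(C:A)},$$ where $C$ is an arbitrary quantum system, the numerator is evaluated on $\mathcal{N}(\rho_{CA})$ and the denominator on $\rho_{CA}$. The contraction coefficient with product reference is $$\eta^{p}_D(\mathcal{N})=\sup_{R,\ \rho_{RA},\ \sigma_A:\ \rho_{RA}\neq\rho_R\otimes\sigma_A}\frac{D(\mathcal{N}(\rho_{RA})\|\rho_R\otimes\mathcal{N}(\sigma_A))}{D(\rho_{RA}\|\rho_R\otimes\sigma_A)}.$$ *)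

theory Defs
  imports Complex_Main "HOL-Library.Extended_Real" "Jordan_Normal_Form.Schur_Decomposition"
    "Jordan_Normal_Form.Matrix_Kernel"
begin

(* A finite-dimensional quantum system is a Hilbert space C^n with n > 0, and operators on it
   are the matrices in carrier_mat n n.  The composite of an m- and an n-dimensional system is
   C^(m * n), where the basis vector e_i (x) e_k has index i * n + k. *)

section \<open>Operators\<close>

definition mat_trace :: "complex mat \<Rightarrow> complex" where
  "mat_trace A = (\<Sum>i<dim_row A. A $$ (i, i))"

definition hermitian :: "complex mat \<Rightarrow> bool" where
  "hermitian A \<longleftrightarrow> mat_adjoint A = A"

definition unitary :: "nat \<Rightarrow> complex mat \<Rightarrow> bool" where
  "unitary n U \<longleftrightarrow> U \<in> carrier_mat n n \<and> U * mat_adjoint U = 1\<^sub>m n \<and> mat_adjoint U * U = 1\<^sub>m n"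

(* In the order on complex numbers used here, 0 \<le> z means that z is real and nonnegative. *)
definition psd :: "nat \<Rightarrow> complex mat \<Rightarrow> bool" where
  "psd n A \<longleftrightarrow> A \<in> carrier_mat n n \<and> hermitian A \<and>
     (\<forall>v\<in>carrier_vec n. 0 \<le> (A *\<^sub>v v) \<bullet>c v)"

definition density :: "nat \<Rightarrow> complex mat \<Rightarrow> bool" where
  "density n \<rho> \<longleftrightarrow> psd n \<rho> \<and> mat_trace \<rho> = 1"

definition tensor :: "complex mat \<Rightarrow> complex mat \<Rightarrow> complex mat" (infixl "\<otimes>\<^sub>m" 70) where
  "A \<otimes>\<^sub>m B = mat (dim_row A * dim_row B) (dim_col A * dim_col B)
     (\<lambda>(i, j). A $$ (i div dim_row B, j div dim_col B) * B $$ (i mod dim_row B, j mod dim_col B))"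

(* marg_fst m n X traces out the second factor of C^m (x) C^n, marg_snd m n X the first one. *)
definition marg_fst :: "nat \<Rightarrow> nat \<Rightarrow> complex mat \<Rightarrow> complex mat" where
  "marg_fst m n X = mat m m (\<lambda>(i, j). \<Sum>k<n. X $$ (i * n + k, j * n + k))"

definition marg_snd :: "nat \<Rightarrow> nat \<Rightarrow> complex mat \<Rightarrow> complex mat" where
  "marg_snd m n X = mat n n (\<lambda>(k, l). \<Sum>i<m. X $$ (i * n + k, i * n + l))"


section \<open>Channels\<close>

definition mat_block :: "nat \<Rightarrow> complex mat \<Rightarrow> nat \<Rightarrow> nat \<Rightarrow> complex mat" where
  "mat_block n X i j = mat n n (\<lambda>(k, l). X $$ (i * n + k, j * n + l))"

(* The map id (x) N: writing X = sum_ij |i><j| (x) X_ij with n x n blocks X_ij, its value at X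
   is sum_ij |i><j| (x) N(X_ij).  Here k is the dimension of the system on which it acts as the
   identity, and N maps n x n matrices to n' x n' matrices. *)
definition extend :: "nat \<Rightarrow> nat \<Rightarrow> nat \<Rightarrow> (complex mat \<Rightarrow> complex mat) \<Rightarrow> complex mat \<Rightarrow> complex mat" where
  "extend k n n' N X = mat (k * n') (k * n')
     (\<lambda>(i, j). N (mat_block n X (i div n') (j div n')) $$ (i mod n', j mod n'))"

definition linear_map :: "nat \<Rightarrow> nat \<Rightarrow> (complex mat \<Rightarrow> complex mat) \<Rightarrow> bool" where
  "linear_map n n' N \<longleftrightarrow>
     (\<forall>X\<in>carrier_mat n n. N X \<in> carrier_mat n' n') \<and>
     (\<forall>X\<in>carrier_mat n n. \<forall>Y\<in>carrier_mat n n. N (X + Y) = N X + N Y) \<and>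
     (\<forall>X\<in>carrier_mat n n. \<forall>c. N (c \<cdot>\<^sub>m X) = c \<cdot>\<^sub>m N X)"

definition completely_positive :: "nat \<Rightarrow> nat \<Rightarrow> (complex mat \<Rightarrow> complex mat) \<Rightarrow> bool" where
  "completely_positive n n' N \<longleftrightarrow> (\<forall>k X. psd (k * n) X \<longrightarrow> psd (k * n') (extend k n n' N X))"

definition trace_preserving :: "nat \<Rightarrow> (complex mat \<Rightarrow> complex mat) \<Rightarrow> bool" where
  "trace_preserving n N \<longleftrightarrow> (\<forall>X\<in>carrier_mat n n. mat_trace (N X) = mat_trace X)"

definition channel :: "nat \<Rightarrow> nat \<Rightarrow> (complex mat \<Rightarrow> complex mat) \<Rightarrow> bool" where
  "channel n n' N \<longleftrightarrow> n > 0 \<and> n' > 0 \<and>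
     linear_map n n' N \<and> completely_positive n n' N \<and> trace_preserving n N"


section \<open>Relative entropy and mutual information\<close>

(* The support of a Hermitian operator is the orthogonal complement of its kernel. *)
definition supp :: "complex mat \<Rightarrow> complex vec set" where
  "supp A = {v \<in> carrier_vec (dim_row A). \<forall>w\<in>mat_kernel A. v \<bullet>c w = 0}"

definition spectral_decomp :: "complex mat \<Rightarrow> complex mat \<Rightarrow> (nat \<Rightarrow> real) \<Rightarrow> bool" where
  "spectral_decomp A U d \<longleftrightarrow> unitary (dim_row A) U \<and>
     A = U * mat_diag (dim_row A) (\<lambda>i. complex_of_real (d i)) * mat_adjoint U"

definition ln_supp :: "real \<Rightarrow> real" where
  "ln_supp x = (if x > 0 then ln x else 0)"

(* The logarithm of a positive semidefinite operator is taken on its support and vanishes on the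
   kernel.  The value does not depend on the chosen spectral decomposition (mat_log_eq below).
   The base of the logarithm cancels in ratios of relative entropies. *)
definition mat_log :: "complex mat \<Rightarrow> complex mat" where
  "mat_log A = (THE L. \<exists>U d. spectral_decomp A U d \<and>
     L = U * mat_diag (dim_row A) (\<lambda>i. complex_of_real (ln_supp (d i))) * mat_adjoint U)"

definition rel_entropy :: "complex mat \<Rightarrow> complex mat \<Rightarrow> ereal" where
  "rel_entropy \<rho> \<sigma> =
     (if supp \<rho> \<subseteq> supp \<sigma> then ereal (Re (mat_trace (\<rho> * (mat_log \<rho> - mat_log \<sigma>)))) else \<infinity>)"

definition mutual_info :: "nat \<Rightarrow> nat \<Rightarrow> complex mat \<Rightarrow> ereal" where
  "mutual_info m n \<rho> = rel_entropy \<rho> (marg_fst m n \<rho> \<otimes>\<^sub>m marg_snd m n \<rho>)"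


section \<open>Contraction coefficients\<close>

definition sup_ratio :: "ereal set \<Rightarrow> ereal" where
  "sup_ratio S = (if S = {} then 0 else Sup S)"

definition eta_MI :: "nat \<Rightarrow> nat \<Rightarrow> (complex mat \<Rightarrow> complex mat) \<Rightarrow> ereal" where
  "eta_MI a b N = sup_ratio
     {mutual_info c b (extend c a b N \<rho>) / mutual_info c a \<rho> | c \<rho>.
        c > 0 \<and> density (c * a) \<rho> \<and>
        0 < mutual_info c a \<rho> \<and> mutual_info c a \<rho> < \<infinity>}"

definition eta_D_prod :: "nat \<Rightarrow> nat \<Rightarrow> (complex mat \<Rightarrow> complex mat) \<Rightarrow> ereal" where
  "eta_D_prod a b N = sup_ratio
     {rel_entropy (extend r a b N \<rho>) (marg_fst r a \<rho> \<otimes>\<^sub>m N \<sigma>)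
        / rel_entropy \<rho> (marg_fst r a \<rho> \<otimes>\<^sub>m \<sigma>) | r \<rho> \<sigma>.
        r > 0 \<and> density (r * a) \<rho> \<and> density a \<sigma> \<and>
        \<rho> \<noteq> marg_fst r a \<rho> \<otimes>\<^sub>m \<sigma> \<and>
        0 < rel_entropy \<rho> (marg_fst r a \<rho> \<otimes>\<^sub>m \<sigma>) \<and>
        rel_entropy \<rho> (marg_fst r a \<rho> \<otimes>\<^sub>m \<sigma>) < \<infinity>}"


section \<open>Basic facts\<close>

lemma block_index_less:
  fixes i k n p :: nat
  assumes "i < k" "p < n"
  shows "i * n + p < k * n"
proof -
  have "i * n + p < Suc i * n" using assms by simp
  also have "\<dots> \<le> k * n" using assms by (intro mult_right_mono) auto
  finally show ?thesis .
qed

lemma extend_tensor: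
  assumes N: "linear_map n n' N" and A: "A \<in> carrier_mat k k" and B: "B \<in> carrier_mat n n"
  shows "extend k n n' N (A \<otimes>\<^sub>m B) = A \<otimes>\<^sub>m N B"
proof -
  have NB: "N B \<in> carrier_mat n' n'" using N B by (auto simp: linear_map_def)
  have blk: "mat_block n (A \<otimes>\<^sub>m B) i j = A $$ (i, j) \<cdot>\<^sub>m B" if "i < k" "j < k" for i j
  proof (rule eq_matI)
    fix p q assume "p < dim_row (A $$ (i, j) \<cdot>\<^sub>m B)" "q < dim_col (A $$ (i, j) \<cdot>\<^sub>m B)"
    then have pq: "p < n" "q < n" using B by auto
    have "i * n + p < k * n" "j * n + q < k * n"
      using that pq by (auto intro: block_index_less)
    then show "mat_block n (A \<otimes>\<^sub>m B) i j $$ (p, q) = (A $$ (i, j) \<cdot>\<^sub>m B) $$ (p, q)"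
      using pq A B by (auto simp: mat_block_def tensor_def)
  qed (use B in \<open>auto simp: mat_block_def\<close>)
  show ?thesis
  proof (rule eq_matI)
    fix i j assume "i < dim_row (A \<otimes>\<^sub>m N B)" "j < dim_col (A \<otimes>\<^sub>m N B)"
    then have ij: "i < k * n'" "j < k * n'" using A NB by (auto simp: tensor_def)
    then have n': "n' > 0" by (cases n') auto
    have d: "i div n' < k" "j div n' < k" using ij by (auto simp: less_mult_imp_div_less)
    have "N (A $$ (i div n', j div n') \<cdot>\<^sub>m B) = A $$ (i div n', j div n') \<cdot>\<^sub>m N B"
      using N B by (auto simp: linear_map_def)
    then have "extend k n n' N (A \<otimes>\<^sub>m B) $$ (i, j)
        = (A $$ (i div n', j div n') \<cdot>\<^sub>m N B) $$ (i mod n', j mod n')"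
      using ij d by (simp add: extend_def blk)
    also have "\<dots> = (A \<otimes>\<^sub>m N B) $$ (i, j)"
      using ij A NB n' by (simp add: tensor_def)
    finally show "extend k n n' N (A \<otimes>\<^sub>m B) $$ (i, j) = (A \<otimes>\<^sub>m N B) $$ (i, j)" .
  qed (use A NB in \<open>auto simp: extend_def tensor_def\<close>)
qed

lemma mat_adjoint_carrier: "A \<in> carrier_mat m n \<Longrightarrow> mat_adjoint A \<in> carrier_mat n m"
  by (auto simp: mat_adjoint_def)

lemma spectral_function_unique:
  fixes f :: "real \<Rightarrow> real"
  assumes U: "unitary n U" and V: "unitary n V"
    and eq: "U * mat_diag n (\<lambda>i. complex_of_real (d i)) * mat_adjoint U
           = V * mat_diag n (\<lambda>i. complex_of_real (e i)) * mat_adjoint V"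
  shows "U * mat_diag n (\<lambda>i. complex_of_real (f (d i))) * mat_adjoint U
       = V * mat_diag n (\<lambda>i. complex_of_real (f (e i))) * mat_adjoint V"
proof -
  define W where "W = mat_adjoint V * U"
  have cU: "U \<in> carrier_mat n n" "mat_adjoint U \<in> carrier_mat n n"
    and cV: "V \<in> carrier_mat n n" "mat_adjoint V \<in> carrier_mat n n"
    using U V by (auto simp: unitary_def intro: mat_adjoint_carrier)
  have cW: "W \<in> carrier_mat n n" using cU cV by (auto simp: W_def)
  have UU: "mat_adjoint U * U = 1\<^sub>m n" "U * mat_adjoint U = 1\<^sub>m n"
    and VV: "mat_adjoint V * V = 1\<^sub>m n" "V * mat_adjoint V = 1\<^sub>m n"
    using U V by (auto simp: unitary_def)
  have left: "mat_adjoint V * (U * D * mat_adjoint U) * U = W * D"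
    if D: "D \<in> carrier_mat n n" for D
  proof -
    have "mat_adjoint V * (U * D * mat_adjoint U) * U
        = mat_adjoint V * (U * (D * (mat_adjoint U * U)))"
      using cU cV D by (simp add: assoc_mult_mat[of _ n n _ n _ n])
    also have "\<dots> = W * D"
      using cU cV D by (simp add: UU W_def assoc_mult_mat[of _ n n _ n _ n])
    finally show ?thesis .
  qed
  have right: "mat_adjoint V * (V * D * mat_adjoint V) * U = D * W"
    if D: "D \<in> carrier_mat n n" for D
  proof -
    have "mat_adjoint V * (V * D * mat_adjoint V) * U
        = (mat_adjoint V * V) * (D * (mat_adjoint V * U))"
      using cU cV D by (simp add: assoc_mult_mat[of _ n n _ n _ n])
    also have "\<dots> = D * W" using cU cV D by (simp add: VV W_def)
    finally show ?thesis .
  qed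
  have WD: "W * mat_diag n (\<lambda>i. complex_of_real (d i)) = mat_diag n (\<lambda>i. complex_of_real (e i)) * W"
    using left[of "mat_diag n (\<lambda>i. complex_of_real (d i))"]
      right[of "mat_diag n (\<lambda>i. complex_of_real (e i))"] eq by simp
  have WF: "W * mat_diag n (\<lambda>i. complex_of_real (f (d i)))
          = mat_diag n (\<lambda>i. complex_of_real (f (e i))) * W"
  proof (rule eq_matI)
    fix i j assume "i < dim_row (mat_diag n (\<lambda>i. complex_of_real (f (e i))) * W)"
      and "j < dim_col (mat_diag n (\<lambda>i. complex_of_real (f (e i))) * W)"
    then have ij: "i < n" "j < n" using cW by (auto simp: mat_diag_def)
    have "W $$ (i, j) * complex_of_real (d j) = complex_of_real (e i) * W $$ (i, j)"
      using arg_cong[OF WD, of "\<lambda>M. M $$ (i, j)"] ij cW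
      by (simp add: mat_diag_mult_left[OF cW] mat_diag_mult_right[OF cW])
    then have "W $$ (i, j) = 0 \<or> d j = e i" by (auto simp: mult.commute)
    then show "(W * mat_diag n (\<lambda>i. complex_of_real (f (d i)))) $$ (i, j)
             = (mat_diag n (\<lambda>i. complex_of_real (f (e i))) * W) $$ (i, j)"
      using ij by (auto simp: mat_diag_mult_left[OF cW] mat_diag_mult_right[OF cW])
  qed (use cW in \<open>auto simp: mat_diag_def\<close>)
  let ?D = "mat_diag n (\<lambda>i. complex_of_real (f (d i)))"
  let ?E = "mat_diag n (\<lambda>i. complex_of_real (f (e i)))"
  have cD: "?D \<in> carrier_mat n n" "?E \<in> carrier_mat n n" by auto
  have cm: "P * Q \<in> carrier_mat n n" if "P \<in> carrier_mat n n" "Q \<in> carrier_mat n n" for P Q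
    using that by (rule mult_carrier_mat)
  have "V * (W * ?D) * mat_adjoint U = V * (mat_adjoint V * (U * ?D * mat_adjoint U))"
    using cU cV cD by (simp add: W_def assoc_mult_mat[of _ n n _ n _ n])
  also have "\<dots> = (V * mat_adjoint V) * (U * ?D * mat_adjoint U)"
    using cU cV cD by (intro assoc_mult_mat[symmetric, of _ n n _ n _ n]) auto
  finally have "V * (W * ?D) * mat_adjoint U = (V * mat_adjoint V) * (U * ?D * mat_adjoint U)" .
  then have 1: "V * (W * ?D) * mat_adjoint U = U * ?D * mat_adjoint U"
    using cU cD by (simp add: VV cm assoc_mult_mat[of _ n n _ n _ n])
  have "V * (?E * W) * mat_adjoint U = V * ?E * mat_adjoint V * (U * mat_adjoint U)"
    using cU cV cD by (simp add: W_def cm assoc_mult_mat[of _ n n _ n _ n])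
  then have 2: "V * (?E * W) * mat_adjoint U = V * ?E * mat_adjoint V"
    using cU cV cD by (simp add: UU cm assoc_mult_mat[of _ n n _ n _ n])
  show ?thesis using 1 2 WF by simp
qed

lemma mat_log_eq:
  assumes "spectral_decomp A U d"
  shows "mat_log A = U * mat_diag (dim_row A) (\<lambda>i. complex_of_real (ln_supp (d i))) * mat_adjoint U"
  unfolding mat_log_def
proof (rule the_equality)
  show "\<exists>U' d'. spectral_decomp A U' d' \<and>
      U * mat_diag (dim_row A) (\<lambda>i. complex_of_real (ln_supp (d i))) * mat_adjoint U
      = U' * mat_diag (dim_row A) (\<lambda>i. complex_of_real (ln_supp (d' i))) * mat_adjoint U'"
    using assms by blast
next
  fix L assume "\<exists>U' d'. spectral_decomp A U' d' \<and>
      L = U' * mat_diag (dim_row A) (\<lambda>i. complex_of_real (ln_supp (d' i))) * mat_adjoint U'"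
  then show "L = U * mat_diag (dim_row A) (\<lambda>i. complex_of_real (ln_supp (d i))) * mat_adjoint U"
    using assms spectral_function_unique[of "dim_row A" _ U _ d ln_supp]
    unfolding spectral_decomp_def by metis
qed

end

(* Taking the reference state to be the marginal of rho shows that every mutual information ratio is
   a ratio with product reference.  For the converse, given a state rho on RA and a state sigma on
   A, let C consist of R and a classical flag bit and consider the state
     omega_p = p |0><0| (x) rho + (1 - p) |1><1| (x) (rho_R (x) sigma).
   Expanding the logarithms of block diagonal and of product operators gives
     I(C:A)_{omega_p} = p D(rho || rho_R (x) sigma) - D(p rho_A + (1 - p) sigma || sigma),
   and the last term lies between 0 and K p^2, the upper bound being a chi-square estimate.  Hence
   I(C:A)_{omega_p} / p tends to D(rho || rho_R (x) sigma) as p tends to 0.  The channel maps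
   omega_p to the flag state of its outputs, so the same limit holds on the output side, and the
   ratios of mutual informations of the omega_p converge to the given ratio. *)

theory Submission
  imports Defs
begin

section \<open>Matrices and the spectral theorem\<close>

text \<open>The obstacle is that mutual information always uses the marginal of the state as its
  reference on A, whereas D(rho || rho_R (x) sigma) exceeds I(R:A) by D(rho_A || sigma), which no
  mutual information of rho itself sees. In omega_p the heavy branch pulls the A-marginal towards
  sigma, and since the branch is a product it adds no correlation of its own. What remains is a
  comparison of orders: the wanted divergence enters with weight p, while the error is a divergence
  from sigma along a segment that starts at sigma, where it is minimal, so it is of order p^2. Two
  further points carry the argument. The logarithm vanishes on kernels, so additivity of logarithms
  holds only where the state has no weight on the kernel of the reference; this kernel condition is
  therefore carried through every identity. It must also survive the channel for the output limit to
  be finite, and it does so as an operator inequality A \<le> c B, which a completely positive map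
  preserves. All traces with logarithms are reduced to finite sums over eigenbases.\<close>

lemma dim_mat_adjoint [simp]:
  "dim_row (mat_adjoint A) = dim_col A" "dim_col (mat_adjoint A) = dim_row A"
  by (auto simp: mat_adjoint_def)

lemma index_mat_adjoint [simp]:
  fixes A :: "complex mat"
  assumes "i < dim_col A" "j < dim_row A"
  shows "mat_adjoint A $$ (i, j) = cnj (A $$ (j, i))"
  using assms by (simp add: mat_adjoint_def mat_of_rows_def)

lemma mat_adjoint_mult:
  fixes A B :: "complex mat"
  assumes "A \<in> carrier_mat m n" "B \<in> carrier_mat n k"
  shows "mat_adjoint (A * B) = mat_adjoint B * mat_adjoint A"
  using assms by (intro eq_matI) (auto simp: scalar_prod_def mult.commute)

lemma mat_adjoint_adjoint [simp]: "mat_adjoint (mat_adjoint A) = (A :: complex mat)"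
  by (intro eq_matI) auto

lemma mat_adjoint_one [simp]: "mat_adjoint (1\<^sub>m n) = (1\<^sub>m n :: complex mat)"
  by (intro eq_matI) auto

lemma mat_adjoint_diag_real:
  "mat_adjoint (mat_diag n (\<lambda>i. complex_of_real (d i))) = mat_diag n (\<lambda>i. complex_of_real (d i))"
  by (intro eq_matI) (auto simp: mat_diag_def)

lemma unitaryD:
  assumes "unitary n U"
  shows "U \<in> carrier_mat n n" "mat_adjoint U \<in> carrier_mat n n" "dim_row U = n" "dim_col U = n"
    "U * mat_adjoint U = 1\<^sub>m n" "mat_adjoint U * U = 1\<^sub>m n"
  using assms mat_adjoint_carrier by (auto simp: unitary_def)

lemma unitary_one: "unitary n (1\<^sub>m n)"
  by (simp add: unitary_def)

text \<open>In finite dimension a left inverse is also a right inverse.\<close>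

lemma unitaryI:
  assumes "U \<in> carrier_mat n n" "mat_adjoint U * U = 1\<^sub>m n"
  shows "unitary n U"
  using assms mat_mult_left_right_inverse[of "mat_adjoint U" n U] mat_adjoint_carrier[of U n n]
  by (auto simp: unitary_def)

lemma unitary_cancel [simp]:
  assumes "unitary n U" "X \<in> carrier_mat n k"
  shows "mat_adjoint U * (U * X) = X" "U * (mat_adjoint U * X) = X"
  using unitaryD[OF assms(1)] assms(2)
  by (simp_all add: assoc_mult_mat[symmetric, of _ n n _ n _ k])

lemma unitary_mult:
  assumes "unitary n U" "unitary n V"
  shows "unitary n (U * V)"
proof (rule unitaryI)
  note U = unitaryD[OF assms(1)] and V = unitaryD[OF assms(2)]
  show "U * V \<in> carrier_mat n n" using U V by auto
  have "mat_adjoint (U * V) * (U * V) = mat_adjoint V * V"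
    using U V assms by (simp add: mat_adjoint_mult[of _ n n _ n] assoc_mult_mat[of _ n n _ n _ n])
  then show "mat_adjoint (U * V) * (U * V) = 1\<^sub>m n" using U V by simp
qed

text \<open>Serves twice: the spectral theorem splits off one eigenvalue with it, and a state with a
  leading classical flag is a direct sum of its two branches.\<close>

definition dsum :: "complex mat \<Rightarrow> complex mat \<Rightarrow> complex mat" where
  "dsum A B = four_block_mat A (0\<^sub>m (dim_row A) (dim_col B)) (0\<^sub>m (dim_row B) (dim_col A)) B"

lemma dim_dsum [simp]:
  "dim_row (dsum A B) = dim_row A + dim_row B" "dim_col (dsum A B) = dim_col A + dim_col B"
  by (auto simp: dsum_def)

lemma dsum_carrier:
  "A \<in> carrier_mat m m' \<Longrightarrow> B \<in> carrier_mat n n' \<Longrightarrow> dsum A B \<in> carrier_mat (m + n) (m' + n')"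
  by (auto simp: dsum_def)

lemma index_dsum:
  assumes "i < dim_row A + dim_row B" "j < dim_col A + dim_col B"
  shows "dsum A B $$ (i, j) = (if i < dim_row A then if j < dim_col A then A $$ (i, j) else 0
     else if j < dim_col A then 0 else B $$ (i - dim_row A, j - dim_col A))"
  using assms by (auto simp: dsum_def)

lemma dsum_mult:
  assumes "A \<in> carrier_mat m m" "B \<in> carrier_mat n n" "A' \<in> carrier_mat m m" "B' \<in> carrier_mat n n"
  shows "dsum A B * dsum A' B' = dsum (A * A') (B * B')"
  using assms unfolding dsum_def
  by (subst mult_four_block_mat[of _ m m _ n _ n _ _ m _ n]) auto

lemma dsum_adjoint: "mat_adjoint (dsum A B) = dsum (mat_adjoint A) (mat_adjoint B)"
  by (intro eq_matI) (auto simp: index_dsum)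

lemma dsum_one: "dsum (1\<^sub>m m) (1\<^sub>m n) = 1\<^sub>m (m + n)"
  by (intro eq_matI) (auto simp: index_dsum)

lemma dsum_diag:
  "dsum (mat_diag m f) (mat_diag n g) = mat_diag (m + n) (\<lambda>i. if i < m then f i else g (i - m))"
  by (intro eq_matI) (auto simp: index_dsum mat_diag_def)

text \<open>A form of \<open>spectral_decomp\<close> with the dimension as a parameter. The
  eigenvalues are unordered and listed with multiplicity, and \<open>d\<close> is arbitrary from
  \<open>n\<close> on, so decompositions of sums and products are obtained by reindexing.\<close>

definition spec :: "nat \<Rightarrow> complex mat \<Rightarrow> complex mat \<Rightarrow> (nat \<Rightarrow> real) \<Rightarrow> bool" where
  "spec n A U d \<longleftrightarrow> unitary n U \<and>
     A = U * mat_diag n (\<lambda>i. complex_of_real (d i)) * mat_adjoint U"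

lemma spec_carrier: "spec n A U d \<Longrightarrow> A \<in> carrier_mat n n"
  using unitaryD(1,2)[of n U] unfolding spec_def
  by (auto intro!: mult_carrier_mat[of _ n n])

lemma spec_spectral_decomp: "spec n A U d \<Longrightarrow> spectral_decomp A U d"
  using spec_carrier[of n A U d] by (auto simp: spec_def spectral_decomp_def)

lemma spec_dsum:
  assumes "spec m A U d" "spec n B V e"
  shows "spec (m + n) (dsum A B) (dsum U V) (\<lambda>i. if i < m then d i else e (i - m))"
proof -
  have u: "unitary m U" "unitary n V" using assms by (auto simp: spec_def)
  note U = unitaryD[OF u(1)] and V = unitaryD[OF u(2)]
  let ?D = "mat_diag m (\<lambda>i. complex_of_real (d i))" and ?E = "mat_diag n (\<lambda>i. complex_of_real (e i))"
  have "unitary (m + n) (dsum U V)"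
    using U V by (auto simp: unitary_def dsum_adjoint dsum_mult[of _ m _ n] dsum_one dsum_carrier)
  moreover have "dsum A B = dsum U V * dsum ?D ?E * mat_adjoint (dsum U V)"
  proof -
    have "dsum A B = dsum (U * ?D * mat_adjoint U) (V * ?E * mat_adjoint V)"
      using assms by (auto simp: spec_def)
    also have "\<dots> = dsum (U * ?D) (V * ?E) * dsum (mat_adjoint U) (mat_adjoint V)"
      by (rule dsum_mult[symmetric, of _ m _ n]) (use U V in \<open>auto intro: mult_carrier_mat[of _ _ n] mult_carrier_mat[of _ _ m]\<close>)
    also have "dsum (U * ?D) (V * ?E) = dsum U V * dsum ?D ?E"
      by (rule dsum_mult[symmetric, of _ m _ n]) (use U V in auto)
    finally show ?thesis by (simp add: dsum_adjoint)
  qed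
  moreover have "(\<lambda>i. complex_of_real (if i < m then d i else e (i - m)))
      = (\<lambda>i. if i < m then complex_of_real (d i) else complex_of_real (e (i - m)))"
    by auto
  ultimately show ?thesis by (simp add: spec_def dsum_diag)
qed

lemma spec_conjugate:
  assumes A: "spec n A U d" and V: "unitary n V"
  shows "spec n (V * A * mat_adjoint V) (V * U) d"
proof -
  have u: "unitary n U" using A by (auto simp: spec_def)
  note U = unitaryD[OF u] and V' = unitaryD[OF V]
  let ?D = "mat_diag n (\<lambda>i. complex_of_real (d i))"
  have D: "?D \<in> carrier_mat n n" by simp
  have "V * A * mat_adjoint V = V * U * ?D * mat_adjoint (V * U)"
    using A U V' D
    by (simp add: spec_def mat_adjoint_mult[of _ n n _ n] assoc_mult_mat[of _ n n _ n _ n]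
        mult_carrier_mat[of _ n n])
  then show ?thesis using unitary_mult[OF V u] by (simp add: spec_def)
qed

section \<open>Unitary diagonalisation of Hermitian matrices\<close>

lemma cscalar_prod_self_pos:
  fixes v :: "complex vec"
  assumes "v \<bullet>c v \<noteq> 0"
  shows "v \<bullet>c v = complex_of_real ((sqrt (Re (v \<bullet>c v)))\<^sup>2)" "sqrt (Re (v \<bullet>c v)) > 0"
proof -
  have e: "v \<bullet>c v = complex_of_real (\<Sum>i<dim_vec v. (cmod (v $ i))\<^sup>2)"
    by (simp add: scalar_prod_def atLeast0LessThan complex_norm_square del: of_real_power)
  have "(\<Sum>i<dim_vec v. (cmod (v $ i))\<^sup>2) \<ge> 0" by (intro sum_nonneg) auto
  moreover have "(\<Sum>i<dim_vec v. (cmod (v $ i))\<^sup>2) \<noteq> 0" using assms unfolding e by (metis of_real_0)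
  ultimately have p: "(\<Sum>i<dim_vec v. (cmod (v $ i))\<^sup>2) > 0" by simp
  show "v \<bullet>c v = complex_of_real ((sqrt (Re (v \<bullet>c v)))\<^sup>2)" "sqrt (Re (v \<bullet>c v)) > 0"
    using p unfolding e by simp_all
qed

text \<open>Complete \<open>v\<close> to a basis and orthogonalise. Gram-Schmidt keeps the first
  vector but returns vectors that are merely orthogonal, so each column is divided by its length
  \<open>s j\<close>; this is where the factor \<open>c\<close> comes from.\<close>

lemma unitary_first_col:
  fixes v :: "complex vec"
  assumes v: "v \<in> carrier_vec n" "v \<noteq> 0\<^sub>v n"
  shows "\<exists>W c. unitary n W \<and> col W 0 = c \<cdot>\<^sub>v v"
proof -
  interpret cof_vec_space n "TYPE(complex)" .
  define b where "b = basis_completion v"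
  define ws where "ws = gram_schmidt n b"
  from basis_completion[OF v, folded b_def]
  have dist_b: "distinct b" and indep: "\<not> lin_dep (set b)" and b: "set b \<subseteq> carrier_vec n"
    and hdb: "hd b = v" and len_b: "length b = n" by auto
  have n: "n \<noteq> 0" using v by (metis eq_vecI carrier_vecD index_zero_vec(2) less_nat_zero_code)
  from hdb len_b n obtain vs where bv: "b = v # vs" by (cases b) auto
  from gram_schmidt_result[OF b dist_b indep refl, folded ws_def]
  have ws: "set ws \<subseteq> carrier_vec n" "corthogonal ws" "length ws = n" by (auto simp: len_b)
  from gram_schmidt_hd[OF v(1), of vs, folded bv] have hdws: "hd ws = v" unfolding ws_def .
  have wsj: "ws ! j \<in> carrier_vec n" if "j < n" for j using ws that by auto
  define s where "s j = sqrt (Re (ws ! j \<bullet>c ws ! j))" for j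
  have nz: "ws ! j \<bullet>c ws ! j \<noteq> 0" if "j < n" for j
    using corthogonalD[OF ws(2), of j j] ws(3) that by auto
  have s: "ws ! j \<bullet>c ws ! j = complex_of_real ((s j)\<^sup>2)" "s j > 0" if "j < n" for j
    by (rule cscalar_prod_self_pos[OF nz[OF that], folded s_def])+
  define W where "W = mat n n (\<lambda>(i, j). ws ! j $ i / complex_of_real (s j))"
  have W: "W \<in> carrier_mat n n" by (simp add: W_def)
  have "mat_adjoint W * W = 1\<^sub>m n"
  proof (rule eq_matI)
    fix i j assume "i < dim_row (1\<^sub>m n)" "j < dim_col (1\<^sub>m n)"
    then have ij: "i < n" "j < n" by auto
    have "(mat_adjoint W * W) $$ (i, j)
        = (\<Sum>k<n. cnj (ws ! i $ k) * ws ! j $ k / (complex_of_real (s i) * complex_of_real (s j)))"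
      using ij W by (simp add: scalar_prod_def atLeast0LessThan W_def)
    also have "\<dots> = (ws ! j \<bullet>c ws ! i) / (complex_of_real (s i) * complex_of_real (s j))"
      using wsj[OF ij(1)] wsj[OF ij(2)]
      by (simp add: scalar_prod_def atLeast0LessThan sum_divide_distrib mult.commute)
    also have "\<dots> = 1\<^sub>m n $$ (i, j)"
    proof (cases "i = j")
      case True
      then show ?thesis using s[OF ij(1)] ij by (simp add: power2_eq_square)
    next
      case False
      then have "ws ! j \<bullet>c ws ! i = 0" using corthogonalD[OF ws(2), of j i] ij ws(3) by auto
      then show ?thesis using False ij by simp
    qed
    finally show "(mat_adjoint W * W) $$ (i, j) = 1\<^sub>m n $$ (i, j)" .
  qed (use W in auto)
  then have "unitary n W" using W by (intro unitaryI)
  moreover have "col W 0 = (1 / complex_of_real (s 0)) \<cdot>\<^sub>v v"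
  proof (rule eq_vecI)
    have "ws ! 0 = v" using hdws ws(3) n by (cases ws) auto
    then show "col W 0 $ i = ((1 / complex_of_real (s 0)) \<cdot>\<^sub>v v) $ i"
      if "i < dim_vec ((1 / complex_of_real (s 0)) \<cdot>\<^sub>v v)" for i
      using that v n by (simp add: W_def)
  qed (use v W in auto)
  ultimately show ?thesis by blast
qed

text \<open>Induction on the dimension: in an orthonormal basis that begins with an eigenvector, a
  Hermitian matrix is the direct sum of the eigenvalue and a smaller Hermitian matrix.\<close>

theorem hermitian_spec:
  assumes "A \<in> carrier_mat n n" "hermitian A"
  shows "\<exists>U d. spec n A U d"
  using assms
proof (induction n arbitrary: A)
  case 0
  then have "spec 0 A (1\<^sub>m 0) (\<lambda>_. 0)" unfolding spec_def using unitary_one[of 0] by auto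
  then show ?case by blast
next
  case (Suc n)
  let ?n = "Suc n"
  obtain as where as: "char_poly A = (\<Prod>a\<leftarrow>as. [:- a, 1:])" "length as = ?n"
    using char_poly_factorized[OF Suc.prems(1)] by blast
  then obtain e where "poly (char_poly A) e = 0"
    by (cases as) auto
  then have "eigenvalue A e" using eigenvalue_root_char_poly[OF Suc.prems(1)] by simp
  then obtain v where v: "v \<in> carrier_vec ?n" "v \<noteq> 0\<^sub>v ?n" and ev: "A *\<^sub>v v = e \<cdot>\<^sub>v v"
    using Suc.prems(1) by (auto simp: eigenvalue_def eigenvector_def)
  obtain W c where uW: "unitary ?n W" and W0: "col W 0 = c \<cdot>\<^sub>v v"
    using unitary_first_col[OF v] by blast
  note W = unitaryD[OF uW] and A = Suc.prems(1)
  have adA: "mat_adjoint A = A" using Suc.prems(2) by (simp add: hermitian_def)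
  define A' where "A' = mat_adjoint W * A * W"
  have A': "A' \<in> carrier_mat ?n ?n" using W A by (auto simp: A'_def)
  have adA': "mat_adjoint A' = A'"
    using W A by (simp add: A'_def mat_adjoint_mult[of _ ?n ?n _ ?n] adA
      assoc_mult_mat[of _ ?n ?n _ ?n _ ?n] mult_carrier_mat[of _ ?n ?n])
  have herm: "A' $$ (i, j) = cnj (A' $$ (j, i))" if "i < ?n" "j < ?n" for i j
    using arg_cong[OF adA', of "\<lambda>M. M $$ (i, j)"] that A' by simp
  \<comment> \<open>The first column of \<open>W\<close> is a multiple of the eigenvector
    \<open>v\<close>, hence itself an eigenvector.\<close>
  have "col (A * W) 0 = e \<cdot>\<^sub>v col W 0"
  proof -
    have "col (A * W) 0 = A *\<^sub>v (c \<cdot>\<^sub>v v)"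
      unfolding W0[symmetric] by (rule col_mult2[of _ ?n ?n _ ?n]) (use A W in auto)
    also have "\<dots> = c \<cdot>\<^sub>v (e \<cdot>\<^sub>v v)" using A v by (simp add: mult_mat_vec[of _ ?n ?n] ev)
    also have "\<dots> = e \<cdot>\<^sub>v col W 0" by (simp add: W0 smult_smult_assoc mult.commute)
    finally show ?thesis .
  qed
  then have col0: "A' $$ (i, 0) = (if i = 0 then e else 0)" if "i < ?n" for i
  proof -
    have "A' $$ (i, 0) = row (mat_adjoint W) i \<bullet> col (A * W) 0"
      using that W A by (simp add: A'_def assoc_mult_mat[of _ ?n ?n _ ?n _ ?n])
    also have "\<dots> = e * (row (mat_adjoint W) i \<bullet> col W 0)"
      using that W \<open>col (A * W) 0 = e \<cdot>\<^sub>v col W 0\<close> by (simp add: scalar_prod_smult_right)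
    also have "row (mat_adjoint W) i \<bullet> col W 0 = (mat_adjoint W * W) $$ (i, 0)"
      using that W(1-4) by simp
    also have "\<dots> = (if i = 0 then 1 else 0)" using that W(6) by simp
    finally show ?thesis by simp
  qed
  define A3 where "A3 = mat n n (\<lambda>(i, j). A' $$ (Suc i, Suc j))"
  have A3: "A3 \<in> carrier_mat n n" "hermitian A3"
  proof -
    show "A3 \<in> carrier_mat n n" by (simp add: A3_def)
    show "hermitian A3" unfolding hermitian_def
    proof (rule eq_matI)
      fix i j assume "i < dim_row A3" "j < dim_col A3"
      then show "mat_adjoint A3 $$ (i, j) = A3 $$ (i, j)"
        using herm[of "Suc i" "Suc j"] by (simp add: A3_def)
    qed (simp_all add: A3_def)
  qed
  then obtain U3 d3 where sp3: "spec n A3 U3 d3" using Suc.IH by blast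
  \<comment> \<open>The eigenvalue is real because it is a diagonal entry of the Hermitian matrix
    \<open>A'\<close>.\<close>
  have ereal: "e = complex_of_real (Re e)"
    using herm[of 0 0] col0[of 0] by (simp add: complex_eq_iff)
  let ?E = "mat 1 1 (\<lambda>_. e)"
  have "?E = 1\<^sub>m 1 * mat_diag 1 (\<lambda>i. complex_of_real (Re e)) * mat_adjoint (1\<^sub>m 1)"
    using ereal by (intro eq_matI) (auto simp: mat_diag_def)
  then have spE: "spec 1 ?E (1\<^sub>m 1) (\<lambda>_. Re e)" unfolding spec_def using unitary_one by simp
  \<comment> \<open>Hermiticity carries the zeros of the first column over to the first row, which
    makes \<open>A'\<close> block diagonal.\<close>
  have row0: "A' $$ (0, j) = (if j = 0 then e else 0)" if "j < ?n" for j
    using herm[OF zero_less_Suc that] col0[OF that] col0[of 0] by (cases j) auto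
  have A'eq: "A' = dsum ?E A3"
  proof (rule eq_matI)
    fix i j assume "i < dim_row (dsum ?E A3)" "j < dim_col (dsum ?E A3)"
    then have ij: "i < ?n" "j < ?n" using A3 by auto
    show "A' $$ (i, j) = dsum ?E A3 $$ (i, j)"
      using ij A3(1) col0 row0
      by (cases i; cases j) (auto simp: index_dsum A3_def)
  qed (use A' A3 in auto)
  have "spec ?n A' (dsum (1\<^sub>m 1) U3) (\<lambda>i. if i < 1 then Re e else d3 (i - 1))"
    using spec_dsum[OF spE sp3] by (simp add: A'eq)
  from spec_conjugate[OF this uW]
  have "spec ?n (W * A' * mat_adjoint W) (W * dsum (1\<^sub>m 1) U3) (\<lambda>i. if i < 1 then Re e else d3 (i - 1))" .
  moreover have "W * A' * mat_adjoint W = A"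
  proof -
    have "W * A' * mat_adjoint W = A * (W * mat_adjoint W)"
      using W A uW unfolding A'_def
      by (simp add: assoc_mult_mat[of _ ?n ?n _ ?n _ ?n] mult_carrier_mat[of _ ?n ?n])
    then show ?thesis using W A by simp
  qed
  ultimately show ?case by auto
qed

section \<open>Traces, positivity and kernels\<close>

lemma mult_mat_vec_zero:
  fixes A :: "complex mat"
  assumes "A \<in> carrier_mat m n"
  shows "A *\<^sub>v 0\<^sub>v n = 0\<^sub>v m"
  using assms by (intro eq_vecI) auto

lemma mat_trace_comm:
  assumes "A \<in> carrier_mat m n" "B \<in> carrier_mat n m"
  shows "mat_trace (A * B) = mat_trace (B * A)"
proof -
  have "mat_trace (A * B) = (\<Sum>i<m. \<Sum>j<n. A $$ (i, j) * B $$ (j, i))"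
    using assms by (auto simp: mat_trace_def scalar_prod_def atLeast0LessThan intro!: sum.cong)
  also have "\<dots> = (\<Sum>j<n. \<Sum>i<m. A $$ (i, j) * B $$ (j, i))" by (rule sum.swap)
  also have "\<dots> = mat_trace (B * A)"
    using assms by (auto simp: mat_trace_def scalar_prod_def atLeast0LessThan mult.commute intro!: sum.cong)
  finally show ?thesis .
qed

lemma mat_trace_add:
  "A \<in> carrier_mat n n \<Longrightarrow> B \<in> carrier_mat n n \<Longrightarrow> mat_trace (A + B) = mat_trace A + mat_trace B"
  by (auto simp: mat_trace_def sum.distrib)

lemma mat_trace_diff:
  "A \<in> carrier_mat n n \<Longrightarrow> B \<in> carrier_mat n n \<Longrightarrow> mat_trace (A - B) = mat_trace A - mat_trace B"
  by (auto simp: mat_trace_def sum_subtractf)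

lemma mat_trace_smult:
  "A \<in> carrier_mat n n \<Longrightarrow> mat_trace (c \<cdot>\<^sub>m A) = c * mat_trace A"
  by (auto simp: mat_trace_def sum_distrib_left)

text \<open>The diagonal of \<open>A\<close> in the basis of the columns of \<open>V\<close>. For a
  state and a unitary \<open>V\<close> it is the outcome distribution of measuring in that
  basis.\<close>

definition diag_in :: "complex mat \<Rightarrow> complex mat \<Rightarrow> nat \<Rightarrow> complex" where
  "diag_in V A k = (mat_adjoint V * A * V) $$ (k, k)"

text \<open>Cyclicity of the trace. Through this identity a trace against a function of
  \<open>B\<close> depends on \<open>A\<close> only through its diagonal in an eigenbasis of
  \<open>B\<close>, which is how every trace with a logarithm is evaluated.\<close>

lemma mat_trace_conj_diag:
  assumes "A \<in> carrier_mat n n" "V \<in> carrier_mat n n"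
  shows "mat_trace (A * (V * mat_diag n f * mat_adjoint V)) = (\<Sum>k<n. diag_in V A k * f k)"
proof -
  have V': "mat_adjoint V \<in> carrier_mat n n" using assms(2) by (rule mat_adjoint_carrier)
  have "mat_trace (A * (V * mat_diag n f * mat_adjoint V))
      = mat_trace ((A * (V * mat_diag n f)) * mat_adjoint V)"
    using assms V' by (simp add: assoc_mult_mat[of _ n n _ n _ n] mult_carrier_mat[of _ n n])
  also have "\<dots> = mat_trace (mat_adjoint V * (A * (V * mat_diag n f)))"
    using assms V' by (intro mat_trace_comm[of _ n n]) auto
  also have "mat_adjoint V * (A * (V * mat_diag n f)) = (mat_adjoint V * A * V) * mat_diag n f"
    using assms V' by (simp add: assoc_mult_mat[of _ n n _ n _ n] mult_carrier_mat[of _ n n])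
  also have "mat_trace \<dots> = (\<Sum>k<n. diag_in V A k * f k)"
    using assms V'
    by (subst mat_diag_mult_right[of _ n])
       (auto simp: mat_trace_def diag_in_def intro!: mult_carrier_mat[of _ n n])
  finally show ?thesis .
qed

lemma sum_diag_in:
  assumes "A \<in> carrier_mat n n" "unitary n V"
  shows "(\<Sum>k<n. diag_in V A k) = mat_trace A"
  using mat_trace_conj_diag[OF assms(1), of V "\<lambda>_. 1"] unitaryD[OF assms(2)] assms(1) by simp

section \<open>Quadratic forms, overlaps of eigenbases and kernels\<close>

lemma cscalar_prod_eq: "dim_vec w = dim_vec (v :: complex vec) \<Longrightarrow> v \<bullet>c w = (\<Sum>i<dim_vec v. v $ i * cnj (w $ i))"
  by (simp add: scalar_prod_def atLeast0LessThan)

lemma cscalar_prod_adjoint: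
  fixes A :: "complex mat"
  assumes "A \<in> carrier_mat m n" "v \<in> carrier_vec n" "w \<in> carrier_vec m"
  shows "(A *\<^sub>v v) \<bullet>c w = v \<bullet>c (mat_adjoint A *\<^sub>v w)"
proof -
  have "(A *\<^sub>v v) \<bullet>c w = (\<Sum>i<m. \<Sum>j<n. A $$ (i, j) * v $ j * cnj (w $ i))"
    using assms by (auto simp: cscalar_prod_eq scalar_prod_def atLeast0LessThan sum_distrib_right
      intro!: sum.cong)
  also have "\<dots> = (\<Sum>j<n. \<Sum>i<m. A $$ (i, j) * v $ j * cnj (w $ i))" by (rule sum.swap)
  also have "\<dots> = v \<bullet>c (mat_adjoint A *\<^sub>v w)"
    using assms by (auto simp: cscalar_prod_eq scalar_prod_def atLeast0LessThan sum_distrib_left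
      mult_ac intro!: sum.cong)
  finally show ?thesis .
qed

lemma diag_in_eq_form:
  assumes "A \<in> carrier_mat n n" "V \<in> carrier_mat n n" "k < n"
  shows "diag_in V A k = (A *\<^sub>v col V k) \<bullet>c col V k"
proof -
  have V': "mat_adjoint V \<in> carrier_mat n n" using assms(2) by (rule mat_adjoint_carrier)
  have "diag_in V A k = (mat_adjoint V * (A * V)) $$ (k, k)"
    using assms V' by (simp add: diag_in_def assoc_mult_mat[of _ n n _ n _ n])
  also have "\<dots> = row (mat_adjoint V) k \<bullet> col (A * V) k" using assms V' by simp
  also have "col (A * V) k = A *\<^sub>v col V k" using assms by (intro col_mult2[of _ n n _ n]) auto
  also have "row (mat_adjoint V) k \<bullet> (A *\<^sub>v col V k) = (A *\<^sub>v col V k) \<bullet>c col V k"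
    using assms by (auto simp: scalar_prod_def mult.commute intro!: sum.cong)
  finally show ?thesis .
qed

lemma spec_diag:
  assumes "spec n A U d"
  shows "mat_adjoint U * A * U = mat_diag n (\<lambda>i. complex_of_real (d i))"
proof -
  let ?D = "mat_diag n (\<lambda>i. complex_of_real (d i))"
  have u: "unitary n U" and A: "A = U * ?D * mat_adjoint U" using assms by (auto simp: spec_def)
  note U = unitaryD[OF u]
  have "mat_adjoint U * A * U = mat_adjoint U * (U * (?D * (mat_adjoint U * U)))"
    unfolding A using U(1,2)
    by (simp add: assoc_mult_mat[of _ n n _ n _ n] mult_carrier_mat[of _ n n])
  also have "\<dots> = ?D"
    using unitary_cancel(1)[OF u mat_diag_dim] by (simp add: U(6) right_mult_one_mat[OF mat_diag_dim])
  finally show ?thesis .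
qed

lemma spec_diag_in: "spec n A U d \<Longrightarrow> k < n \<Longrightarrow> diag_in U A k = complex_of_real (d k)"
  by (simp add: diag_in_def spec_diag mat_diag_def)

lemma mat_diag_mult_vec:
  fixes c :: "complex vec"
  assumes "c \<in> carrier_vec n"
  shows "mat_diag n f *\<^sub>v c = vec n (\<lambda>i. f i * c $ i)"
proof (rule eq_vecI)
  fix i assume "i < dim_vec (vec n (\<lambda>i. f i * c $ i))"
  then have i: "i < n" by simp
  have "(mat_diag n f *\<^sub>v c) $ i = (\<Sum>j<n. (if i = j then f j else 0) * c $ j)"
    using i assms by (simp add: mat_diag_def scalar_prod_def atLeast0LessThan)
  also have "\<dots> = (\<Sum>j<n. if i = j then f j * c $ j else 0)" by (intro sum.cong) auto
  finally show "(mat_diag n f *\<^sub>v c) $ i = vec n (\<lambda>i. f i * c $ i) $ i" using i by simp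
qed (use assms in \<open>auto simp: mat_diag_def\<close>)

lemma complex_of_real_nonneg_iff [simp]: "0 \<le> complex_of_real r \<longleftrightarrow> 0 \<le> r"
  by (simp add: less_eq_complex_def)

lemma spec_form:
  assumes "spec n A U d" and v: "v \<in> carrier_vec n"
  shows "(A *\<^sub>v v) \<bullet>c v = complex_of_real (\<Sum>i<n. d i * (cmod ((mat_adjoint U *\<^sub>v v) $ i))\<^sup>2)"
proof -
  let ?D = "mat_diag n (\<lambda>i. complex_of_real (d i))"
  have u: "unitary n U" and A: "A = U * ?D * mat_adjoint U" using assms by (auto simp: spec_def)
  note U = unitaryD[OF u]
  let ?c = "mat_adjoint U *\<^sub>v v"
  have c: "?c \<in> carrier_vec n" using U v by auto
  have "A *\<^sub>v v = U *\<^sub>v (?D *\<^sub>v ?c)"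
    unfolding A using U v c
    by (simp only: assoc_mult_mat_vec[of _ n n _ n] mult_carrier_mat[of _ n n] mat_diag_dim)
  also have "\<dots> \<bullet>c v = (?D *\<^sub>v ?c) \<bullet>c ?c"
    by (rule cscalar_prod_adjoint[of _ n n]) (use U(1) v c mult_mat_vec_carrier[OF mat_diag_dim c] in auto)
  also have "?D *\<^sub>v ?c = vec n (\<lambda>i. complex_of_real (d i) * ?c $ i)"
    using c by (rule mat_diag_mult_vec)
  also have "\<dots> \<bullet>c ?c = (\<Sum>i<n. complex_of_real (d i) * ?c $ i * cnj (?c $ i))"
    using c U(3,4) by (subst cscalar_prod_eq) simp_all
  also have "\<dots> = complex_of_real (\<Sum>i<n. d i * (cmod (?c $ i))\<^sup>2)"
    by (simp add: complex_norm_square mult.assoc del: of_real_power)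
  finally show ?thesis .
qed

lemma spec_hermitian:
  assumes "spec n A U d"
  shows "hermitian A"
proof -
  let ?D = "mat_diag n (\<lambda>i. complex_of_real (d i))"
  have u: "unitary n U" and A: "A = U * ?D * mat_adjoint U" using assms by (auto simp: spec_def)
  note U = unitaryD[OF u]
  show ?thesis unfolding hermitian_def A using U(1,2)
    by (simp add: mat_adjoint_mult[of _ n n _ n] assoc_mult_mat[of _ n n _ n _ n]
      mult_carrier_mat[of _ n n] mat_adjoint_diag_real)
qed

lemma spec_psd:
  assumes "spec n A U d" "\<And>i. i < n \<Longrightarrow> 0 \<le> d i"
  shows "psd n A"
  using spec_carrier[OF assms(1)] spec_hermitian[OF assms(1)] spec_form[OF assms(1)] assms(2)
  by (auto simp: psd_def simp del: of_real_sum of_real_mult of_real_power intro!: sum_nonneg)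

lemma psd_diag_in_nonneg:
  assumes "psd n A" "V \<in> carrier_mat n n" "k < n"
  shows "0 \<le> diag_in V A k"
  using assms by (auto simp: psd_def diag_in_eq_form)

lemma psdE:
  assumes "psd n A"
  obtains U d where "spec n A U d" "\<And>i. i < n \<Longrightarrow> 0 \<le> d i"
proof -
  obtain U d where s: "spec n A U d" using assms hermitian_spec[of A n] by (auto simp: psd_def)
  have "0 \<le> d i" if "i < n" for i
    using psd_diag_in_nonneg[OF assms, of U i] that s spec_diag_in[OF s]
    by (simp add: spec_def unitaryD)
  then show thesis by (rule that[OF s])
qed

text \<open>In eigencoordinates the form is a sum of nonnegative terms, so each vanishes: every
  coordinate or its eigenvalue is zero.\<close>

lemma psd_form_eq_0:
  assumes "psd n A" "v \<in> carrier_vec n" "(A *\<^sub>v v) \<bullet>c v = 0"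
  shows "A *\<^sub>v v = 0\<^sub>v n"
proof -
  obtain U d where s: "spec n A U d" and d: "\<And>i. i < n \<Longrightarrow> 0 \<le> d i" by (rule psdE[OF assms(1)]) blast
  let ?D = "mat_diag n (\<lambda>i. complex_of_real (d i))"
  have u: "unitary n U" and A: "A = U * ?D * mat_adjoint U" using s by (auto simp: spec_def)
  note U = unitaryD[OF u]
  let ?c = "mat_adjoint U *\<^sub>v v"
  have c: "?c \<in> carrier_vec n" using U assms by auto
  have "(\<Sum>i<n. d i * (cmod (?c $ i))\<^sup>2) = 0"
    using assms(3) unfolding spec_form[OF s assms(2)] by (metis of_real_eq_0_iff)
  then have "d i * (cmod (?c $ i))\<^sup>2 = 0" if "i < n" for i
    using that d by (subst (asm) sum_nonneg_eq_0_iff) auto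
  then have z: "d i = 0 \<or> ?c $ i = 0" if "i < n" for i using that by fastforce
  have "?D *\<^sub>v ?c = 0\<^sub>v n"
    using z by (intro eq_vecI) (auto simp: mat_diag_mult_vec[OF c])
  moreover have "A *\<^sub>v v = U *\<^sub>v (?D *\<^sub>v ?c)"
    unfolding A using U assms c
    by (simp only: assoc_mult_mat_vec[of _ n n _ n] mult_carrier_mat[of _ n n] mat_diag_dim)
  ultimately show ?thesis using mult_mat_vec_zero[OF U(1)] by simp
qed

text \<open>Squared moduli of the inner products between the columns of \<open>U\<close> and those
  of \<open>W\<close>. For unitary matrices this array is doubly stochastic;
  \<open>overlap_sum_right\<close> and \<open>overlap_commute\<close> together give both kinds of
  sums.\<close>

definition overlap :: "complex mat \<Rightarrow> complex mat \<Rightarrow> nat \<Rightarrow> nat \<Rightarrow> real" where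
  "overlap U W i k = (cmod ((mat_adjoint U * W) $$ (i, k)))\<^sup>2"

lemma overlap_nonneg [simp]: "0 \<le> overlap U W i k"
  by (simp add: overlap_def)

lemma diag_in_overlap:
  assumes s: "spec n A U d" and W: "W \<in> carrier_mat n n" "k < n"
  shows "diag_in W A k = complex_of_real (\<Sum>i<n. d i * overlap U W i k)"
proof -
  have "U \<in> carrier_mat n n" using s by (auto simp: spec_def unitaryD)
  then have "mat_adjoint U *\<^sub>v col W k = col (mat_adjoint U * W) k"
    using W by (intro col_mult2[symmetric, of _ n n _ n] mat_adjoint_carrier) auto
  then show ?thesis
    using W spec_form[OF s, of "col W k"] \<open>U \<in> carrier_mat n n\<close> spec_carrier[OF s]
    by (simp add: diag_in_eq_form overlap_def)
qed

lemma overlap_sum_right: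
  assumes "unitary n U" "unitary n W" "i < n"
  shows "(\<Sum>k<n. overlap U W i k) = 1"
proof -
  note U = unitaryD[OF assms(1)] and W = unitaryD[OF assms(2)]
  let ?Q = "mat_adjoint U * W"
  have Q: "?Q \<in> carrier_mat n n" using U W by auto
  have "?Q * mat_adjoint ?Q = 1\<^sub>m n"
    using U W assms(2) by (simp add: mat_adjoint_mult[of _ n n _ n] assoc_mult_mat[of _ n n _ n _ n]
      mult_carrier_mat[of _ n n])
  then have "(?Q * mat_adjoint ?Q) $$ (i, i) = 1" using assms(3) by simp
  moreover have "(?Q * mat_adjoint ?Q) $$ (i, i) = complex_of_real (\<Sum>k<n. overlap U W i k)"
    using Q assms(3) U W unfolding overlap_def of_real_sum complex_norm_square
    by (subst index_mult_mat) (simp_all add: scalar_prod_def atLeast0LessThan)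
  ultimately show ?thesis by (metis of_real_eq_1_iff)
qed

lemma overlap_commute:
  assumes "unitary n U" "unitary n W" "i < n" "k < n"
  shows "overlap U W i k = overlap W U k i"
proof -
  note U = unitaryD[OF assms(1)] and W = unitaryD[OF assms(2)]
  have "mat_adjoint U * W = mat_adjoint (mat_adjoint W * U)"
    using U W by (simp add: mat_adjoint_mult[of _ n n _ n])
  then have "(mat_adjoint U * W) $$ (i, k) = cnj ((mat_adjoint W * U) $$ (k, i))"
    using assms U W by simp
  then show ?thesis unfolding overlap_def by (metis complex_mod_cnj)
qed

text \<open>The dual form of the support condition, with the reference operator as first argument.
  Kernels are easier to handle than supports because they are read off from the zero
  eigenvalues.\<close>

definition ker_le :: "nat \<Rightarrow> complex mat \<Rightarrow> complex mat \<Rightarrow> bool" where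
  "ker_le n B A \<longleftrightarrow> (\<forall>v\<in>carrier_vec n. B *\<^sub>v v = 0\<^sub>v n \<longrightarrow> A *\<^sub>v v = 0\<^sub>v n)"

lemma supp_subset_iff_ker_le:
  assumes A: "A \<in> carrier_mat n n" "hermitian A" and B: "B \<in> carrier_mat n n"
  shows "supp A \<subseteq> supp B \<longleftrightarrow> ker_le n B A"
proof
  assume sub: "supp A \<subseteq> supp B"
  show "ker_le n B A" unfolding ker_le_def
  proof (intro ballI impI)
    fix w assume w: "w \<in> carrier_vec n" "B *\<^sub>v w = 0\<^sub>v n"
    then have wB: "w \<in> mat_kernel B" using B by (auto simp: mat_kernel_def)
    have adj: "(A *\<^sub>v x) \<bullet>c y = x \<bullet>c (A *\<^sub>v y)" if "x \<in> carrier_vec n" "y \<in> carrier_vec n" for x y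
      using cscalar_prod_adjoint[OF A(1) that] A(2) by (simp add: hermitian_def)
    have Aw: "A *\<^sub>v w \<in> carrier_vec n" using A w by auto
    \<comment> \<open>The test vector lies in the range of \<open>A\<close> and hence in its
      support; being orthogonal to \<open>w\<close> in the kernel of \<open>B\<close>, it forces the
      squared length of \<open>A *\<^sub>v w\<close> to vanish.\<close>
    have "A *\<^sub>v (A *\<^sub>v w) \<in> supp A"
      using A Aw adj[OF Aw] by (auto simp: supp_def mat_kernel_def)
    then have "(A *\<^sub>v (A *\<^sub>v w)) \<bullet>c w = 0" using sub wB by (auto simp: supp_def)
    then have "(A *\<^sub>v w) \<bullet>c (A *\<^sub>v w) = 0" using adj[OF Aw w(1)] by simp
    then show "A *\<^sub>v w = 0\<^sub>v n" using Aw by simp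
  qed
next
  assume "ker_le n B A"
  then show "supp A \<subseteq> supp B" using A B by (auto simp: supp_def mat_kernel_def ker_le_def)
qed

text \<open>The kernel of \<open>B\<close> is spanned by its eigenvectors for the eigenvalue 0, and
  a positive semidefinite \<open>A\<close> annihilates a vector as soon as its quadratic form
  vanishes there. The kernel condition thus says that \<open>A\<close> has no weight where the
  reference vanishes.\<close>

lemma ker_le_iff_diag_in:
  assumes A: "psd n A" and B: "spec n B W e"
  shows "ker_le n B A \<longleftrightarrow> (\<forall>k<n. e k = 0 \<longrightarrow> diag_in W A k = 0)"
proof -
  let ?E = "mat_diag n (\<lambda>i. complex_of_real (e i))"
  have w: "unitary n W" and Beq: "B = W * ?E * mat_adjoint W" using B by (auto simp: spec_def)
  note W = unitaryD[OF w]
  have cA: "A \<in> carrier_mat n n" using A by (simp add: psd_def)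
  show ?thesis
  proof (intro iffI allI impI)
    fix k assume le: "ker_le n B A" and k: "k < n" "e k = 0"
    have "B * W = W * ?E"
      using W(1,2,6) unfolding Beq
      by (simp add: assoc_mult_mat[of _ n n _ n _ n] mult_carrier_mat[of _ n n] right_mult_one_mat[OF mat_diag_dim])
    then have "B *\<^sub>v col W k = col (W * ?E) k"
      using col_mult2[of B n n W n k] k W(1) spec_carrier[OF B] by simp
    also have "\<dots> = 0\<^sub>v n"
      using k W(1) by (intro eq_vecI) (auto simp: mat_diag_mult_right[OF W(1)])
    finally have "A *\<^sub>v col W k = 0\<^sub>v n" using le k W(3) by (auto simp: ker_le_def)
    then show "diag_in W A k = 0" using cA W k by (simp add: diag_in_eq_form)
  next
    assume z: "\<forall>k<n. e k = 0 \<longrightarrow> diag_in W A k = 0"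
    have Ak: "A *\<^sub>v col W k = 0\<^sub>v n" if "k < n" "e k = 0" for k
      using psd_form_eq_0[OF A, of "col W k"] z that cA W(1,3) by (auto simp: diag_in_eq_form)
    show "ker_le n B A" unfolding ker_le_def
    proof (intro ballI impI)
      fix v assume v: "v \<in> carrier_vec n" "B *\<^sub>v v = 0\<^sub>v n"
      define c where "c = mat_adjoint W *\<^sub>v v"
      have c: "c \<in> carrier_vec n" using W v by (auto simp: c_def)
      have "mat_adjoint W *\<^sub>v (B *\<^sub>v v) = (mat_adjoint W * B * W) *\<^sub>v c"
      proof -
        have "(mat_adjoint W * B * W) *\<^sub>v c = mat_adjoint W *\<^sub>v (B *\<^sub>v ((W * mat_adjoint W) *\<^sub>v v))"
          unfolding c_def using W(1,2) v(1) spec_carrier[OF B]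
          by (simp add: assoc_mult_mat_vec[of _ n n _ n] mult_carrier_mat[of _ n n])
        then show ?thesis using W(5) v(1) by simp
      qed
      then have Ec: "?E *\<^sub>v c = 0\<^sub>v n" using v(2) W(2) mult_mat_vec_zero[OF W(2)] by (simp add: spec_diag[OF B])
      \<comment> \<open>A vector in the kernel of \<open>B\<close> has nonzero eigencoordinates only
        at zero eigenvalues, where \<open>Ak\<close> applies.\<close>
      have ec: "e k = 0 \<or> c $ k = 0" if "k < n" for k
        using arg_cong[OF Ec, of "\<lambda>x. x $ k"] that c
        by (auto simp: mat_diag_mult_vec[OF c])
      have "A *\<^sub>v v = A *\<^sub>v ((W * mat_adjoint W) *\<^sub>v v)" using W(5) v by simp
      also have "\<dots> = (A * W) *\<^sub>v c"
        unfolding c_def using W(1,2) v(1) cA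
        by (simp add: assoc_mult_mat_vec[of _ n n _ n] mult_carrier_mat[of _ n n])
      also have "\<dots> = 0\<^sub>v n"
      proof (rule eq_vecI)
        fix i assume "i < dim_vec (0\<^sub>v n)"
        then have i: "i < n" by simp
        have "(A * W) $$ (i, k) * c $ k = 0" if "k < n" for k
        proof (cases "e k = 0")
          case True
          have "(A * W) $$ (i, k) = (A *\<^sub>v col W k) $ i" using that i cA W(1) by simp
          then show ?thesis using Ak[OF that True] i by simp
        qed (use ec that in auto)
        then have "(\<Sum>k<n. (A * W) $$ (i, k) * c $ k) = 0" by (intro sum.neutral) auto
        moreover have "((A * W) *\<^sub>v c) $ i = (\<Sum>k<n. (A * W) $$ (i, k) * c $ k)"
          using i c cA W(1) by (subst index_mult_mat_vec) (simp_all add: scalar_prod_def atLeast0LessThan)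
        ultimately show "((A * W) *\<^sub>v c) $ i = 0\<^sub>v n $ i" using i by simp
      qed (use cA in auto)
      finally show "A *\<^sub>v v = 0\<^sub>v n" .
    qed
  qed
qed

section \<open>Tensor products and partial traces\<close>

lemma sum_prod_index:
  fixes f :: "nat \<Rightarrow> 'a :: comm_monoid_add"
  shows "(\<Sum>k<m * n. f k) = (\<Sum>i<m. \<Sum>j<n. f (i * n + j))"
proof -
  have "(\<Sum>k<m * n. f k) = (\<Sum>i<m. sum f {i * n..<i * n + n})" by (rule sum.nat_group[symmetric])
  also have "\<dots> = (\<Sum>i<m. \<Sum>j<n. f (i * n + j))"
    by (rule sum.cong[OF refl], subst sum.atLeastLessThan_shift_0) (simp add: atLeast0LessThan)
  finally show ?thesis .
qed

lemma tensor_carrier: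
  "A \<in> carrier_mat m m' \<Longrightarrow> B \<in> carrier_mat n n' \<Longrightarrow> A \<otimes>\<^sub>m B \<in> carrier_mat (m * n) (m' * n')"
  by (auto simp: tensor_def)

lemma dim_tensor [simp]:
  "dim_row (A \<otimes>\<^sub>m B) = dim_row A * dim_row B" "dim_col (A \<otimes>\<^sub>m B) = dim_col A * dim_col B"
  by (auto simp: tensor_def)

lemma index_tensor:
  "i < dim_row A * dim_row B \<Longrightarrow> j < dim_col A * dim_col B \<Longrightarrow>
    (A \<otimes>\<^sub>m B) $$ (i, j) = A $$ (i div dim_row B, j div dim_col B) * B $$ (i mod dim_row B, j mod dim_col B)"
  by (simp add: tensor_def)

lemma div_mod_less:
  fixes i m n :: nat
  assumes "i < m * n"
  shows "i div n < m" "i mod n < n"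
  using assms by (auto simp: less_mult_imp_div_less intro!: mod_less_divisor) (metis gr0I mult_0_right not_less0)

lemma div_mod_block:
  fixes i k n :: nat
  assumes "k < n"
  shows "(i * n + k) div n = i" "(i * n + k) mod n = k"
  using assms by auto

lemma tensor_mult:
  assumes "A \<in> carrier_mat m m" "B \<in> carrier_mat n n" "A' \<in> carrier_mat m m" "B' \<in> carrier_mat n n"
  shows "(A \<otimes>\<^sub>m B) * (A' \<otimes>\<^sub>m B') = (A * A') \<otimes>\<^sub>m (B * B')"
proof (rule eq_matI)
  fix i j assume "i < dim_row (A * A' \<otimes>\<^sub>m (B * B'))" "j < dim_col (A * A' \<otimes>\<^sub>m (B * B'))"
  then have ij: "i < m * n" "j < m * n" using assms by auto
  note l = div_mod_less[OF ij(1)] div_mod_less[OF ij(2)]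
  have "((A \<otimes>\<^sub>m B) * (A' \<otimes>\<^sub>m B')) $$ (i, j)
      = (\<Sum>k<m * n. A $$ (i div n, k div n) * B $$ (i mod n, k mod n)
          * (A' $$ (k div n, j div n) * B' $$ (k mod n, j mod n)))"
    using ij assms by (simp add: scalar_prod_def atLeast0LessThan index_tensor)
  also have "\<dots> = (\<Sum>p<m. \<Sum>q<n. (A $$ (i div n, p) * A' $$ (p, j div n))
      * (B $$ (i mod n, q) * B' $$ (q, j mod n)))"
    unfolding sum_prod_index by (intro sum.cong refl) (simp add: div_mod_block mult_ac)
  also have "\<dots> = (\<Sum>p<m. A $$ (i div n, p) * A' $$ (p, j div n))
      * (\<Sum>q<n. B $$ (i mod n, q) * B' $$ (q, j mod n))"
    by (simp add: sum_product)
  also have "\<dots> = (A * A' \<otimes>\<^sub>m (B * B')) $$ (i, j)"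
    using ij assms l by (simp add: index_tensor scalar_prod_def atLeast0LessThan)
  finally show "((A \<otimes>\<^sub>m B) * (A' \<otimes>\<^sub>m B')) $$ (i, j) = (A * A' \<otimes>\<^sub>m (B * B')) $$ (i, j)" .
qed (use assms in auto)

lemma tensor_adjoint: "mat_adjoint (A \<otimes>\<^sub>m B) = mat_adjoint A \<otimes>\<^sub>m mat_adjoint B"
  by (intro eq_matI) (auto simp: index_tensor div_mod_less)

lemma tensor_diag:
  "mat_diag m f \<otimes>\<^sub>m mat_diag n g = mat_diag (m * n) (\<lambda>i. f (i div n) * g (i mod n))"
proof (rule eq_matI)
  fix i j assume "i < dim_row (mat_diag (m * n) (\<lambda>i. f (i div n) * g (i mod n)))"
    "j < dim_col (mat_diag (m * n) (\<lambda>i. f (i div n) * g (i mod n)))"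
  then have ij: "i < m * n" "j < m * n" by (auto simp: mat_diag_def)
  have "i = j \<longleftrightarrow> i div n = j div n \<and> i mod n = j mod n"
    by (metis div_mult_mod_eq)
  then show "(mat_diag m f \<otimes>\<^sub>m mat_diag n g) $$ (i, j)
      = mat_diag (m * n) (\<lambda>i. f (i div n) * g (i mod n)) $$ (i, j)"
    using ij div_mod_less[OF ij(1)] div_mod_less[OF ij(2)]
    by (auto simp: mat_diag_def index_tensor)
qed (auto simp: mat_diag_def)

lemma tensor_one: "1\<^sub>m m \<otimes>\<^sub>m 1\<^sub>m n = 1\<^sub>m (m * n)"
  using tensor_diag[of m "\<lambda>_. 1" n "\<lambda>_. 1"] by simp

lemma unitary_tensor:
  assumes "unitary m U" "unitary n V"
  shows "unitary (m * n) (U \<otimes>\<^sub>m V)"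
proof -
  note U = unitaryD[OF assms(1)] and V = unitaryD[OF assms(2)]
  show ?thesis
    using U V tensor_carrier[OF U(1) V(1)]
      tensor_mult[OF U(1) V(1) U(2) V(2)] tensor_mult[OF U(2) V(2) U(1) V(1)]
    by (simp add: unitary_def tensor_adjoint tensor_one)
qed

lemma tensor_conj_diag:
  assumes "unitary m U" "unitary n V"
  shows "(U * mat_diag m f * mat_adjoint U) \<otimes>\<^sub>m (V * mat_diag n g * mat_adjoint V)
     = (U \<otimes>\<^sub>m V) * mat_diag (m * n) (\<lambda>i. f (i div n) * g (i mod n)) * mat_adjoint (U \<otimes>\<^sub>m V)"
proof -
  note U = unitaryD[OF assms(1)] and V = unitaryD[OF assms(2)]
  have "(U * mat_diag m f * mat_adjoint U) \<otimes>\<^sub>m (V * mat_diag n g * mat_adjoint V)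
      = ((U * mat_diag m f) \<otimes>\<^sub>m (V * mat_diag n g)) * (mat_adjoint U \<otimes>\<^sub>m mat_adjoint V)"
    by (rule tensor_mult[symmetric])
       (use U(1,2) V(1,2) mult_carrier_mat[OF U(1) mat_diag_dim] mult_carrier_mat[OF V(1) mat_diag_dim] in auto)
  also have "(U * mat_diag m f) \<otimes>\<^sub>m (V * mat_diag n g)
      = (U \<otimes>\<^sub>m V) * (mat_diag m f \<otimes>\<^sub>m mat_diag n g)"
    by (rule tensor_mult[symmetric]) (use U(1) V(1) in auto)
  finally show ?thesis by (simp add: tensor_diag tensor_adjoint)
qed

lemma spec_tensor:
  assumes "spec m A U d" "spec n B V e"
  shows "spec (m * n) (A \<otimes>\<^sub>m B) (U \<otimes>\<^sub>m V) (\<lambda>i. d (i div n) * e (i mod n))"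
  using assms unitary_tensor[of m U n V] tensor_conj_diag[of m U n V]
  unfolding spec_def by simp

lemma psd_tensor:
  assumes "psd m A" "psd n B"
  shows "psd (m * n) (A \<otimes>\<^sub>m B)"
proof -
  obtain U d where 1: "spec m A U d" "\<And>i. i < m \<Longrightarrow> 0 \<le> d i" by (rule psdE[OF assms(1)]) blast
  obtain V e where 2: "spec n B V e" "\<And>i. i < n \<Longrightarrow> 0 \<le> e i" by (rule psdE[OF assms(2)]) blast
  show ?thesis
    by (rule spec_psd[OF spec_tensor[OF 1(1) 2(1)]]) (use 1(2) 2(2) div_mod_less in auto)
qed

lemma psd_dsum:
  assumes "psd m A" "psd n B"
  shows "psd (m + n) (dsum A B)"
proof -
  obtain U d where 1: "spec m A U d" "\<And>i. i < m \<Longrightarrow> 0 \<le> d i" by (rule psdE[OF assms(1)]) blast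
  obtain V e where 2: "spec n B V e" "\<And>i. i < n \<Longrightarrow> 0 \<le> e i" by (rule psdE[OF assms(2)]) blast
  show ?thesis
    by (rule spec_psd[OF spec_dsum[OF 1(1) 2(1)]]) (use 1(2) 2(2) in auto)
qed

lemma spec_smult:
  assumes "spec n A U d"
  shows "spec n (complex_of_real c \<cdot>\<^sub>m A) U (\<lambda>i. c * d i)"
proof -
  let ?D = "mat_diag n (\<lambda>i. complex_of_real (d i))"
  have u: "unitary n U" and A: "A = U * ?D * mat_adjoint U" using assms by (auto simp: spec_def)
  note U = unitaryD[OF u]
  have D: "mat_diag n (\<lambda>i. complex_of_real (c * d i)) = complex_of_real c \<cdot>\<^sub>m ?D"
    by (intro eq_matI) (auto simp: mat_diag_def)
  have "U * (complex_of_real c \<cdot>\<^sub>m ?D) * mat_adjoint U = complex_of_real c \<cdot>\<^sub>m (U * ?D * mat_adjoint U)"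
    using mult_smult_distrib[OF U(1) mat_diag_dim] mult_smult_assoc_mat[OF mult_carrier_mat[OF U(1) mat_diag_dim] U(2)]
    by simp
  then show ?thesis using u A D unfolding spec_def by simp
qed

lemma psd_smult:
  assumes "psd n A" "0 \<le> c"
  shows "psd n (complex_of_real c \<cdot>\<^sub>m A)"
proof -
  obtain U d where 1: "spec n A U d" "\<And>i. i < n \<Longrightarrow> 0 \<le> d i" by (rule psdE[OF assms(1)]) blast
  show ?thesis by (rule spec_psd[OF spec_smult[OF 1(1)]]) (use 1(2) assms(2) in auto)
qed

lemma hermitian_add:
  assumes "A \<in> carrier_mat n n" "B \<in> carrier_mat n n" "hermitian A" "hermitian B"
  shows "hermitian (A + B)"
proof -
  have "mat_adjoint (A + B) = mat_adjoint A + mat_adjoint B"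
    using assms(1,2) by (intro eq_matI) auto
  then show ?thesis using assms by (simp add: hermitian_def)
qed

lemma psd_add:
  assumes "psd n A" "psd n B"
  shows "psd n (A + B)"
  using assms hermitian_add[of A n B]
  by (auto simp: psd_def add_mult_distrib_mat_vec[of _ n n] add_scalar_prod_distrib[of _ n])

section \<open>Partial traces\<close>

lemma marg_carrier [simp]:
  "marg_fst m n X \<in> carrier_mat m m" "marg_snd m n X \<in> carrier_mat n n"
  by (auto simp: marg_fst_def marg_snd_def)

text \<open>The partial trace is dual to tensoring with the identity. This turns expectations of
  one-sided observables into expectations in the marginal.\<close>

lemma mat_trace_tensor_fst:
  assumes W: "W \<in> carrier_mat (m * n) (m * n)" and X: "X \<in> carrier_mat m m"
  shows "mat_trace (W * (X \<otimes>\<^sub>m 1\<^sub>m n)) = mat_trace (marg_fst m n W * X)"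
proof -
  have "mat_trace (W * (X \<otimes>\<^sub>m 1\<^sub>m n))
      = (\<Sum>a<m * n. \<Sum>b<m * n. W $$ (a, b) * (X $$ (b div n, a div n) * 1\<^sub>m n $$ (b mod n, a mod n)))"
    using W X by (auto simp: mat_trace_def scalar_prod_def atLeast0LessThan index_tensor intro!: sum.cong)
  also have "\<dots> = (\<Sum>i<m. \<Sum>k<n. \<Sum>j<m. \<Sum>l<n.
      W $$ (i * n + k, j * n + l) * (X $$ (j, i) * (if l = k then 1 else 0)))"
    unfolding sum_prod_index by (intro sum.cong refl) (simp add: div_mod_block)
  also have "\<dots> = (\<Sum>i<m. \<Sum>k<n. \<Sum>j<m. W $$ (i * n + k, j * n + k) * X $$ (j, i))"
    by (intro sum.cong refl) (simp add: if_distrib[of "\<lambda>x. _ * x"] sum.delta cong: if_cong)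
  also have "\<dots> = (\<Sum>i<m. \<Sum>j<m. \<Sum>k<n. W $$ (i * n + k, j * n + k) * X $$ (j, i))"
    by (rule sum.cong[OF refl]) (rule sum.swap)
  also have "\<dots> = mat_trace (marg_fst m n W * X)"
    using X by (auto simp: mat_trace_def scalar_prod_def atLeast0LessThan marg_fst_def sum_distrib_right
      intro!: sum.cong)
  finally show ?thesis .
qed

lemma mat_trace_tensor_snd:
  assumes W: "W \<in> carrier_mat (m * n) (m * n)" and Y: "Y \<in> carrier_mat n n"
  shows "mat_trace (W * (1\<^sub>m m \<otimes>\<^sub>m Y)) = mat_trace (marg_snd m n W * Y)"
proof -
  have "mat_trace (W * (1\<^sub>m m \<otimes>\<^sub>m Y))
      = (\<Sum>a<m * n. \<Sum>b<m * n. W $$ (a, b) * (1\<^sub>m m $$ (b div n, a div n) * Y $$ (b mod n, a mod n)))"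
    using W Y by (auto simp: mat_trace_def scalar_prod_def atLeast0LessThan index_tensor intro!: sum.cong)
  also have "\<dots> = (\<Sum>i<m. \<Sum>k<n. \<Sum>j<m. \<Sum>l<n.
      W $$ (i * n + k, j * n + l) * ((if j = i then 1 else 0) * Y $$ (l, k)))"
    unfolding sum_prod_index by (intro sum.cong refl) (simp add: div_mod_block)
  also have "\<dots> = (\<Sum>i<m. \<Sum>k<n. \<Sum>l<n. W $$ (i * n + k, i * n + l) * Y $$ (l, k))"
  proof (rule sum.cong[OF refl], rule sum.cong[OF refl])
    fix i k assume "i \<in> {..<m}" "k \<in> {..<n}"
    have "(\<Sum>j<m. \<Sum>l<n. W $$ (i * n + k, j * n + l) * ((if j = i then 1 else 0) * Y $$ (l, k)))
        = (\<Sum>j<m. if j = i then \<Sum>l<n. W $$ (i * n + k, j * n + l) * Y $$ (l, k) else 0)"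
      by (intro sum.cong) auto
    then show "(\<Sum>j<m. \<Sum>l<n. W $$ (i * n + k, j * n + l) * ((if j = i then 1 else 0) * Y $$ (l, k)))
        = (\<Sum>l<n. W $$ (i * n + k, i * n + l) * Y $$ (l, k))"
      using \<open>i \<in> {..<m}\<close> by simp
  qed
  also have "\<dots> = (\<Sum>k<n. \<Sum>i<m. \<Sum>l<n. W $$ (i * n + k, i * n + l) * Y $$ (l, k))"
    by (rule sum.swap)
  also have "\<dots> = (\<Sum>k<n. \<Sum>l<n. \<Sum>i<m. W $$ (i * n + k, i * n + l) * Y $$ (l, k))"
    by (rule sum.cong[OF refl]) (rule sum.swap)
  also have "\<dots> = mat_trace (marg_snd m n W * Y)"
    using Y by (auto simp: mat_trace_def scalar_prod_def atLeast0LessThan marg_snd_def sum_distrib_right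
      intro!: sum.cong)
  finally show ?thesis .
qed

lemma mat_trace_prod_index:
  assumes "X \<in> carrier_mat (m * n) (m * n)"
  shows "mat_trace X = (\<Sum>i<m. \<Sum>k<n. X $$ (i * n + k, i * n + k))"
  using assms by (simp add: mat_trace_def sum_prod_index)

lemma mat_trace_marg:
  assumes "X \<in> carrier_mat (m * n) (m * n)"
  shows "mat_trace (marg_fst m n X) = mat_trace X" "mat_trace (marg_snd m n X) = mat_trace X"
proof -
  show "mat_trace (marg_fst m n X) = mat_trace X"
    unfolding mat_trace_prod_index[OF assms] by (simp add: mat_trace_def marg_fst_def)
  show "mat_trace (marg_snd m n X) = mat_trace X"
    unfolding mat_trace_prod_index[OF assms]
    by (simp add: mat_trace_def marg_snd_def) (rule sum.swap)
qed

lemma marg_tensor: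
  assumes "A \<in> carrier_mat m m" "B \<in> carrier_mat n n"
  shows "marg_fst m n (A \<otimes>\<^sub>m B) = mat_trace B \<cdot>\<^sub>m A" "marg_snd m n (A \<otimes>\<^sub>m B) = mat_trace A \<cdot>\<^sub>m B"
  using assms
  by (auto intro!: eq_matI simp: marg_fst_def marg_snd_def index_tensor div_mod_block mat_trace_def
      block_index_less sum_distrib_left sum_distrib_right mult.commute)

text \<open>In a product basis the diagonal of \<open>W\<close> is a joint distribution over index
  pairs, whose marginals are the diagonals of the partial traces. Testing against arbitrary
  functions covers both later uses: indicators for positivity and kernels, logarithms for
  entropies.\<close>

lemma diag_in_marg:
  assumes W: "W \<in> carrier_mat (m * n) (m * n)" and U: "unitary m U" and V: "unitary n V"
  shows "(\<Sum>k<m * n. diag_in (U \<otimes>\<^sub>m V) W k * f (k div n)) = (\<Sum>i<m. diag_in U (marg_fst m n W) i * f i)"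
    and "(\<Sum>k<m * n. diag_in (U \<otimes>\<^sub>m V) W k * g (k mod n)) = (\<Sum>i<n. diag_in V (marg_snd m n W) i * g i)"
proof -
  note cU = unitaryD[OF U] and cV = unitaryD[OF V]
  note UV = unitaryD(1)[OF unitary_tensor[OF U V]]
  have one: "U * 1\<^sub>m m * mat_adjoint U = 1\<^sub>m m" "V * 1\<^sub>m n * mat_adjoint V = 1\<^sub>m n"
    using cU cV by simp_all
  have cc: "U * mat_diag m f * mat_adjoint U \<in> carrier_mat m m" "V * mat_diag n g * mat_adjoint V \<in> carrier_mat n n"
    using mult_carrier_mat[OF mult_carrier_mat[OF cU(1) mat_diag_dim] cU(2)]
      mult_carrier_mat[OF mult_carrier_mat[OF cV(1) mat_diag_dim] cV(2)] by auto
  have "(\<Sum>k<m * n. diag_in (U \<otimes>\<^sub>m V) W k * f (k div n))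
      = mat_trace (W * ((U * mat_diag m f * mat_adjoint U) \<otimes>\<^sub>m 1\<^sub>m n))"
    using mat_trace_conj_diag[OF W UV] tensor_conj_diag[OF U V, of f "\<lambda>_. 1"] by (simp add: one)
  also have "\<dots> = (\<Sum>i<m. diag_in U (marg_fst m n W) i * f i)"
    using mat_trace_tensor_fst[OF W cc(1)] mat_trace_conj_diag[OF _ cU(1)] by simp
  finally show "(\<Sum>k<m * n. diag_in (U \<otimes>\<^sub>m V) W k * f (k div n)) = (\<Sum>i<m. diag_in U (marg_fst m n W) i * f i)" .
  have "(\<Sum>k<m * n. diag_in (U \<otimes>\<^sub>m V) W k * g (k mod n))
      = mat_trace (W * (1\<^sub>m m \<otimes>\<^sub>m (V * mat_diag n g * mat_adjoint V)))"
    using mat_trace_conj_diag[OF W UV] tensor_conj_diag[OF U V, of "\<lambda>_. 1" g] by (simp add: one)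
  also have "\<dots> = (\<Sum>i<n. diag_in V (marg_snd m n W) i * g i)"
    using mat_trace_tensor_snd[OF W cc(2)] mat_trace_conj_diag[OF _ cV(1)] by simp
  finally show "(\<Sum>k<m * n. diag_in (U \<otimes>\<^sub>m V) W k * g (k mod n)) = (\<Sum>i<n. diag_in V (marg_snd m n W) i * g i)" .
qed

lemma hermitian_index:
  "hermitian A \<Longrightarrow> A \<in> carrier_mat n n \<Longrightarrow> i < n \<Longrightarrow> j < n \<Longrightarrow> cnj (A $$ (j, i)) = A $$ (i, j)"
  unfolding hermitian_def using index_mat_adjoint[of i A j] by auto

text \<open>Hermiticity first provides eigenbases of the marginals. Each eigenvalue is then, by
  \<open>diag_in_marg\<close> with an indicator function, a sum of diagonal entries of
  \<open>X\<close> in the product basis, all nonnegative.\<close>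

lemma psd_marg:
  assumes X: "psd (m * n) X"
  shows "psd m (marg_fst m n X)" "psd n (marg_snd m n X)"
proof -
  have cX: "X \<in> carrier_mat (m * n) (m * n)" and hX: "hermitian X" using X by (auto simp: psd_def)
  note h = hermitian_index[OF hX cX]
  have h1: "hermitian (marg_fst m n X)"
    unfolding hermitian_def by (intro eq_matI) (auto simp: marg_fst_def h block_index_less)
  have h2: "hermitian (marg_snd m n X)"
    unfolding hermitian_def by (intro eq_matI) (auto simp: marg_snd_def h block_index_less)
  obtain U d where U: "spec m (marg_fst m n X) U d" using hermitian_spec[OF marg_carrier(1) h1] by blast
  obtain V e where V: "spec n (marg_snd m n X) V e" using hermitian_spec[OF marg_carrier(2) h2] by blast
  have u: "unitary m U" "unitary n V" using U V by (auto simp: spec_def)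
  note UV = unitaryD(1)[OF unitary_tensor[OF u]]
  have p: "0 \<le> diag_in (U \<otimes>\<^sub>m V) X k" if "k < m * n" for k
    using psd_diag_in_nonneg[OF X UV that] .
  show "psd m (marg_fst m n X)"
  proof (rule spec_psd[OF U])
    fix i assume i: "i < m"
    have "complex_of_real (d i) = (\<Sum>k<m. diag_in U (marg_fst m n X) k * (if k = i then 1 else 0))"
      using i spec_diag_in[OF U] by (simp add: if_distrib[of "\<lambda>x. _ * x"] sum.delta cong: if_cong)
    also have "\<dots> = (\<Sum>k<m * n. diag_in (U \<otimes>\<^sub>m V) X k * (if k div n = i then 1 else 0))"
      by (rule diag_in_marg(1)[OF cX u, symmetric])
    also have "0 \<le> \<dots>" using p by (intro sum_nonneg) auto
    finally show "0 \<le> d i" by simp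
  qed
  show "psd n (marg_snd m n X)"
  proof (rule spec_psd[OF V])
    fix i assume i: "i < n"
    have "complex_of_real (e i) = (\<Sum>k<n. diag_in V (marg_snd m n X) k * (if k = i then 1 else 0))"
      using i spec_diag_in[OF V] by (simp add: if_distrib[of "\<lambda>x. _ * x"] sum.delta cong: if_cong)
    also have "\<dots> = (\<Sum>k<m * n. diag_in (U \<otimes>\<^sub>m V) X k * (if k mod n = i then 1 else 0))"
      by (rule diag_in_marg(2)[OF cX u, symmetric])
    also have "0 \<le> \<dots>" using p by (intro sum_nonneg) auto
    finally show "0 \<le> e i" by simp
  qed
qed

text \<open>The reason why mutual information is always finite. Where an eigenvalue of a marginal is
  zero, the nonnegative diagonal entries of \<open>X\<close> over that index sum to zero, hence
  vanish one by one.\<close>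

lemma ker_le_marg_tensor:
  assumes X: "psd (m * n) X"
  shows "ker_le (m * n) (marg_fst m n X \<otimes>\<^sub>m marg_snd m n X) X"
proof -
  have cX: "X \<in> carrier_mat (m * n) (m * n)" using X by (auto simp: psd_def)
  obtain U d where U: "spec m (marg_fst m n X) U d" by (rule psdE[OF psd_marg(1)[OF X]]) blast
  obtain V e where V: "spec n (marg_snd m n X) V e" by (rule psdE[OF psd_marg(2)[OF X]]) blast
  have u: "unitary m U" "unitary n V" using U V by (auto simp: spec_def)
  note UV = unitaryD(1)[OF unitary_tensor[OF u]]
  have p: "0 \<le> diag_in (U \<otimes>\<^sub>m V) X k" if "k < m * n" for k
    using psd_diag_in_nonneg[OF X UV that] .
  have "diag_in (U \<otimes>\<^sub>m V) X k = 0" if k: "k < m * n" "d (k div n) = 0" for k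
  proof -
    have "(\<Sum>k<m * n. diag_in (U \<otimes>\<^sub>m V) X k * (if d (k div n) = 0 then 1 else 0))
        = (\<Sum>i<m. diag_in U (marg_fst m n X) i * (if d i = 0 then 1 else 0))"
      by (rule diag_in_marg(1)[OF cX u])
    also have "\<dots> = 0" by (intro sum.neutral) (auto simp: spec_diag_in[OF U])
    finally have "\<forall>k\<in>{..<m * n}. diag_in (U \<otimes>\<^sub>m V) X k * (if d (k div n) = 0 then 1 else 0) = 0"
      using p by (subst (asm) sum_nonneg_eq_0_iff) auto
    then show ?thesis using k by auto
  qed
  moreover have "diag_in (U \<otimes>\<^sub>m V) X k = 0" if k: "k < m * n" "e (k mod n) = 0" for k
  proof -
    have "(\<Sum>k<m * n. diag_in (U \<otimes>\<^sub>m V) X k * (if e (k mod n) = 0 then 1 else 0))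
        = (\<Sum>i<n. diag_in V (marg_snd m n X) i * (if e i = 0 then 1 else 0))"
      by (rule diag_in_marg(2)[OF cX u])
    also have "\<dots> = 0" by (intro sum.neutral) (auto simp: spec_diag_in[OF V])
    finally have "\<forall>k\<in>{..<m * n}. diag_in (U \<otimes>\<^sub>m V) X k * (if e (k mod n) = 0 then 1 else 0) = 0"
      using p by (subst (asm) sum_nonneg_eq_0_iff) auto
    then show ?thesis using k by auto
  qed
  ultimately show ?thesis using ker_le_iff_diag_in[OF X spec_tensor[OF U V]] by auto
qed

section \<open>Entropy\<close>

text \<open>\<open>log_tr A A\<close> is minus the von Neumann entropy of a state \<open>A\<close>.
  Keeping the two halves of a relative entropy apart allows the calculations to be made in the
  reals.\<close>

definition log_tr :: "complex mat \<Rightarrow> complex mat \<Rightarrow> real" where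
  "log_tr A B = Re (mat_trace (A * mat_log B))"

lemma spec_mat_log:
  assumes "spec n B W e"
  shows "mat_log B = W * mat_diag n (\<lambda>i. complex_of_real (ln_supp (e i))) * mat_adjoint W"
  using mat_log_eq[OF spec_spectral_decomp[OF assms]] spec_carrier[OF assms] by simp

lemma mat_log_carrier:
  assumes "psd n B"
  shows "mat_log B \<in> carrier_mat n n"
proof -
  obtain W e where s: "spec n B W e" by (rule psdE[OF assms]) blast
  then have "unitary n W" by (simp add: spec_def)
  note W = unitaryD[OF this]
  show ?thesis
    unfolding spec_mat_log[OF s]
    by (rule mult_carrier_mat[OF mult_carrier_mat[OF W(1) mat_diag_dim] W(2)])
qed

lemma log_tr_spec:
  assumes "A \<in> carrier_mat n n" "spec n B W e"
  shows "log_tr A B = (\<Sum>k<n. Re (diag_in W A k) * ln_supp (e k))"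
proof -
  have "W \<in> carrier_mat n n" using assms(2) by (auto simp: spec_def unitaryD)
  then show ?thesis
    unfolding log_tr_def spec_mat_log[OF assms(2)] using mat_trace_conj_diag[OF assms(1)] by simp
qed

lemma log_tr_self:
  assumes "spec n A U d"
  shows "log_tr A A = (\<Sum>k<n. d k * ln_supp (d k))"
  using log_tr_spec[OF spec_carrier[OF assms] assms] by (simp add: spec_diag_in[OF assms])

lemma log_tr_add:
  assumes "A \<in> carrier_mat n n" "A' \<in> carrier_mat n n" "psd n B"
  shows "log_tr (A + A') B = log_tr A B + log_tr A' B"
  using assms mat_log_carrier[OF assms(3)]
  by (simp add: log_tr_def add_mult_distrib_mat[of _ n n] mat_trace_add[of _ n] mult_carrier_mat[of _ n n])

lemma log_tr_smult:
  assumes "A \<in> carrier_mat n n" "psd n B"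
  shows "log_tr (complex_of_real c \<cdot>\<^sub>m A) B = c * log_tr A B"
  using assms mat_log_carrier[OF assms(2)]
  by (simp add: log_tr_def mult_smult_assoc_mat[of _ n n] mat_trace_smult[of _ n] mult_carrier_mat[of _ n n])

lemma rel_entropy_eq:
  assumes A: "psd n A" and B: "psd n B"
  shows "rel_entropy A B = (if ker_le n B A then ereal (log_tr A A - log_tr A B) else \<infinity>)"
proof -
  have c: "A \<in> carrier_mat n n" "B \<in> carrier_mat n n" "hermitian A" using A B by (auto simp: psd_def)
  have "mat_trace (A * (mat_log A - mat_log B)) = mat_trace (A * mat_log A) - mat_trace (A * mat_log B)"
    using c mat_log_carrier[OF A] mat_log_carrier[OF B]
    by (simp add: mult_minus_distrib_mat[of _ n n] mat_trace_diff[of _ n] mult_carrier_mat[of _ n n])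
  then show ?thesis
    using supp_subset_iff_ker_le[OF c(1,3,2)] by (simp add: rel_entropy_def log_tr_def)
qed

lemma ln_supp_mult: "0 < x \<Longrightarrow> 0 < y \<Longrightarrow> ln_supp (x * y) = ln_supp x + ln_supp y"
  by (simp add: ln_supp_def ln_mult)

text \<open>\<open>ln_supp\<close> is additive on products of positive numbers but not when exactly
  one factor vanishes, as it sends 0 to 0. The kernel condition gives those index pairs weight zero,
  and on the others the logarithm splits.\<close>

lemma log_tr_tensor:
  assumes X: "psd (m * n) X" and A: "psd m A" and B: "psd n B" and le: "ker_le (m * n) (A \<otimes>\<^sub>m B) X"
  shows "log_tr X (A \<otimes>\<^sub>m B) = log_tr (marg_fst m n X) A + log_tr (marg_snd m n X) B"
proof -
  obtain U d where U: "spec m A U d" and d: "\<And>i. i < m \<Longrightarrow> 0 \<le> d i" by (rule psdE[OF A]) blast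
  obtain V e where V: "spec n B V e" and e: "\<And>i. i < n \<Longrightarrow> 0 \<le> e i" by (rule psdE[OF B]) blast
  have u: "unitary m U" "unitary n V" using U V by (auto simp: spec_def)
  have cX: "X \<in> carrier_mat (m * n) (m * n)" using X by (auto simp: psd_def)
  note UV = spec_tensor[OF U V]
  let ?p = "diag_in (U \<otimes>\<^sub>m V) X"
  have summand: "Re (?p k) * ln_supp (d (k div n) * e (k mod n))
      = Re (?p k * complex_of_real (ln_supp (d (k div n)))) + Re (?p k * complex_of_real (ln_supp (e (k mod n))))"
    if k: "k < m * n" for k
  proof (cases "d (k div n) * e (k mod n) = 0")
    case True
    then have "?p k = 0" using le ker_le_iff_diag_in[OF X UV] k by blast
    then show ?thesis by simp
  next
    case False
    then have "0 < d (k div n)" "0 < e (k mod n)"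
      using d[OF div_mod_less(1)[OF k]] e[OF div_mod_less(2)[OF k]] by auto
    then show ?thesis by (simp add: ln_supp_mult algebra_simps)
  qed
  have "log_tr X (A \<otimes>\<^sub>m B) = (\<Sum>k<m * n. Re (?p k) * ln_supp (d (k div n) * e (k mod n)))"
    by (rule log_tr_spec[OF cX UV])
  also have "\<dots> = Re (\<Sum>k<m * n. ?p k * complex_of_real (ln_supp (d (k div n))))
      + Re (\<Sum>k<m * n. ?p k * complex_of_real (ln_supp (e (k mod n))))"
    using summand unfolding Re_sum sum.distrib[symmetric] by (intro sum.cong) auto
  also have "\<dots> = log_tr (marg_fst m n X) A + log_tr (marg_snd m n X) B"
    using diag_in_marg(1)[OF cX u, of "\<lambda>i. complex_of_real (ln_supp (d i))"]
      diag_in_marg(2)[OF cX u, of "\<lambda>i. complex_of_real (ln_supp (e i))"]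
    by (simp add: log_tr_spec[OF marg_carrier(1) U] log_tr_spec[OF marg_carrier(2) V])
  finally show ?thesis .
qed

section \<open>Density operators and the entropies of products, direct sums and multiples\<close>

lemma densityD:
  assumes "density n A"
  shows "psd n A" "A \<in> carrier_mat n n" "mat_trace A = 1"
  using assms by (auto simp: density_def psd_def)

lemma smult_smult_mat: "a \<cdot>\<^sub>m (b \<cdot>\<^sub>m A) = (a * b :: complex) \<cdot>\<^sub>m A"
  by (intro eq_matI) auto

lemma smult_one_mat [simp]: "(1::complex) \<cdot>\<^sub>m A = A"
  by (intro eq_matI) auto

lemma density_marg:
  assumes "density (m * n) X"
  shows "density m (marg_fst m n X)" "density n (marg_snd m n X)"
  using densityD[OF assms] psd_marg[of m n X] mat_trace_marg[of X m n] by (auto simp: density_def)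

lemma mat_trace_tensor:
  assumes "A \<in> carrier_mat m m" "B \<in> carrier_mat n n"
  shows "mat_trace (A \<otimes>\<^sub>m B) = mat_trace A * mat_trace B"
  using mat_trace_marg(1)[OF tensor_carrier[OF assms]] marg_tensor(1)[OF assms] mat_trace_smult[OF assms(1)]
  by (simp add: mult.commute)

lemma density_tensor:
  assumes "density m A" "density n B"
  shows "density (m * n) (A \<otimes>\<^sub>m B)"
  using densityD[OF assms(1)] densityD[OF assms(2)] psd_tensor mat_trace_tensor
  by (auto simp: density_def)

lemma log_tr_self_tensor:
  assumes "density m A" "density n B"
  shows "log_tr (A \<otimes>\<^sub>m B) (A \<otimes>\<^sub>m B) = log_tr A A + log_tr B B"
proof -
  note A = densityD[OF assms(1)] and B = densityD[OF assms(2)]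
  show ?thesis
    using log_tr_tensor[OF psd_tensor[OF A(1) B(1)] A(1) B(1)] marg_tensor[OF A(2) B(2)] A(3) B(3)
    by (simp add: ker_le_def)
qed

lemma sum_split_lessThan:
  fixes f :: "nat \<Rightarrow> 'a :: comm_monoid_add"
  shows "(\<Sum>i<m + n. f i) = (\<Sum>i<m. f i) + (\<Sum>i<n. f (m + i))"
  by (induction n) (auto simp: add.assoc)

lemma log_tr_self_dsum:
  assumes "psd m A" "psd n B"
  shows "log_tr (dsum A B) (dsum A B) = log_tr A A + log_tr B B"
proof -
  obtain U d where U: "spec m A U d" by (rule psdE[OF assms(1)]) blast
  obtain V e where V: "spec n B V e" by (rule psdE[OF assms(2)]) blast
  show ?thesis
    using log_tr_self[OF spec_dsum[OF U V]] log_tr_self[OF U] log_tr_self[OF V]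
    by (simp add: sum_split_lessThan)
qed

lemma spec_trace:
  assumes "spec n A U d"
  shows "mat_trace A = complex_of_real (\<Sum>k<n. d k)"
proof -
  have "unitary n U" using assms by (simp add: spec_def)
  then show ?thesis
    using sum_diag_in[OF spec_carrier[OF assms], of U] spec_diag_in[OF assms] by simp
qed

text \<open>Applied to the branches of a flag state, the term with \<open>c * ln c\<close> is the
  entropy of the flag; it occurs equally in the joint state and in its marginal on C and cancels in
  \<open>mutual_info_flag\<close>.\<close>

lemma log_tr_self_smult:
  assumes "psd n A" "0 < c"
  shows "log_tr (complex_of_real c \<cdot>\<^sub>m A) (complex_of_real c \<cdot>\<^sub>m A)
    = c * log_tr A A + c * ln c * Re (mat_trace A)"
proof -
  obtain U d where U: "spec n A U d" and d: "\<And>i. i < n \<Longrightarrow> 0 \<le> d i" by (rule psdE[OF assms(1)]) blast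
  have "c * d k * ln_supp (c * d k) = c * (d k * ln_supp (d k)) + c * ln c * d k" if "k < n" for k
    using d[OF that] assms(2) by (cases "d k = 0") (auto simp: ln_supp_def ln_mult algebra_simps zero_less_mult_iff)
  then show ?thesis
    unfolding log_tr_self[OF spec_smult[OF U]] log_tr_self[OF U] spec_trace[OF U]
    by (simp add: sum_distrib_left sum.distrib)
qed

section \<open>The chi-square bound and its behaviour along a mixture\<close>

lemma diag_in_add:
  assumes "A \<in> carrier_mat n n" "B \<in> carrier_mat n n" "W \<in> carrier_mat n n" "k < n"
  shows "diag_in W (A + B) k = diag_in W A k + diag_in W B k"
  using assms mat_adjoint_carrier[OF assms(3)]
  by (simp add: diag_in_def mult_add_distrib_mat[of _ n n] add_mult_distrib_mat[of _ n n]
      mult_carrier_mat[of _ n n] del: index_mult_mat(1))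

lemma diag_in_smult:
  assumes "A \<in> carrier_mat n n" "W \<in> carrier_mat n n" "k < n"
  shows "diag_in W (c \<cdot>\<^sub>m A) k = c * diag_in W A k"
  using assms mat_adjoint_carrier[OF assms(2)] mult_carrier_mat[OF mat_adjoint_carrier[OF assms(2)] assms(1)]
  by (simp add: diag_in_def mult_smult_distrib[of _ n n] mult_smult_assoc_mat[of _ n n] del: index_mult_mat(1))

text \<open>For the cross terms in the square of a mixture: \<open>A\<close> and \<open>B\<close>
  need not commute, yet in an eigenbasis of \<open>B\<close> the diagonals of \<open>A * B\<close>
  and \<open>B * A\<close> agree.\<close>

lemma diag_in_spec_mult:
  assumes B: "spec n B W e" and A: "A \<in> carrier_mat n n" and k: "k < n"
  shows "diag_in W (B * A) k = complex_of_real (e k) * diag_in W A k"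
    and "diag_in W (A * B) k = complex_of_real (e k) * diag_in W A k"
proof -
  let ?E = "mat_diag n (\<lambda>i. complex_of_real (e i))"
  have w: "unitary n W" and Beq: "B = W * ?E * mat_adjoint W" using B by (auto simp: spec_def)
  note W = unitaryD[OF w]
  have M: "mat_adjoint W * A * W \<in> carrier_mat n n"
    by (rule mult_carrier_mat[OF mult_carrier_mat[OF W(2) A] W(1)])
  have "mat_adjoint W * (B * A) * W = (mat_adjoint W * W) * (?E * (mat_adjoint W * A * W))"
    unfolding Beq using W(1,2) A by (simp only: assoc_mult_mat[of _ n n _ n _ n] mult_carrier_mat[of _ n n] mat_diag_dim)
  then show "diag_in W (B * A) k = complex_of_real (e k) * diag_in W A k"
    unfolding diag_in_def W(6)
    using k M by (simp add: mat_diag_mult_left[OF M] left_mult_one_mat[of _ n n] mult_carrier_mat[of _ n n] del: index_mult_mat)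
  have "mat_adjoint W * (A * B) * W = (mat_adjoint W * A * W) * (?E * (mat_adjoint W * W))"
    unfolding Beq using W(1,2) A by (simp only: assoc_mult_mat[of _ n n _ n _ n] mult_carrier_mat[of _ n n] mat_diag_dim)
  then show "diag_in W (A * B) k = complex_of_real (e k) * diag_in W A k"
    unfolding diag_in_def W(6)
    using k M by (simp add: mat_diag_mult_right[OF M] right_mult_one_mat[OF mat_diag_dim] mult.commute del: index_mult_mat)
qed

lemma spec_square:
  assumes "spec n A U d"
  shows "spec n (A * A) U (\<lambda>i. d i * d i)"
proof -
  let ?D = "mat_diag n (\<lambda>i. complex_of_real (d i))"
  have u: "unitary n U" and A: "A = U * ?D * mat_adjoint U" using assms by (auto simp: spec_def)
  note U = unitaryD[OF u]
  have "A * A = U * (?D * ((mat_adjoint U * U) * (?D * mat_adjoint U)))"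
    unfolding A using U(1,2) by (simp only: assoc_mult_mat[of _ n n _ n _ n] mult_carrier_mat[of _ n n] mat_diag_dim)
  also have "\<dots> = U * ((?D * ?D) * mat_adjoint U)"
    using U(1,2) unfolding U(6)
    by (simp only: assoc_mult_mat[of _ n n _ n _ n] mult_carrier_mat[of _ n n] mat_diag_dim left_mult_one_mat[of _ n n])
  also have "\<dots> = U * mat_diag n (\<lambda>i. complex_of_real (d i * d i)) * mat_adjoint U"
    using U(1,2) by (simp add: assoc_mult_mat[of _ n n _ n _ n])
  finally show ?thesis using u by (simp add: spec_def)
qed

text \<open>The relative entropy of \<open>A\<close> and \<open>B\<close> is the classical one of the Nussbaum-Szkola distributions
  \<open>d i * Q i k\<close> and \<open>e k * Q i k\<close>, where \<open>Q\<close> is the overlap of the two eigenbases; both bounds then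
  follow termwise from \<open>1 - 1 / x \<le> ln x \<le> x - 1\<close>.  Terms with \<open>e k = 0\<close> vanish, as \<open>x / 0 = 0\<close>.\<close>

lemma rel_entropy_bounds:
  assumes A: "density n A" and B: "density n B" and sB: "spec n B W e" and le: "ker_le n B A"
  shows "0 \<le> log_tr A A - log_tr A B"
    and "log_tr A A - log_tr A B \<le> (\<Sum>k<n. Re (diag_in W (A * A) k) / e k) - 1"
proof -
  note A' = densityD[OF A] and B' = densityD[OF B]
  obtain U d where U: "spec n A U d" and d: "\<And>i. i < n \<Longrightarrow> 0 \<le> d i" by (rule psdE[OF A'(1)]) blast
  have u: "unitary n U" "unitary n W" using U sB by (auto simp: spec_def)
  have cW: "W \<in> carrier_mat n n" using unitaryD[OF u(2)] by simp
  have e: "0 \<le> e k" if "k < n" for k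
    using psd_diag_in_nonneg[OF B'(1) cW that] spec_diag_in[OF sB that] by simp
  define Q where "Q = overlap U W"
  have Q: "0 \<le> Q i k" for i k by (simp add: Q_def)
  have Qr: "(\<Sum>k<n. Q i k) = 1" if "i < n" for i
    using overlap_sum_right[OF u that] by (simp add: Q_def)
  have Qc: "(\<Sum>i<n. Q i k) = 1" if "k < n" for k
  proof -
    have "(\<Sum>i<n. Q i k) = (\<Sum>i<n. overlap W U k i)"
      unfolding Q_def using overlap_commute[OF u] that by (intro sum.cong) auto
    then show ?thesis using overlap_sum_right[OF u(2,1) that] by simp
  qed
  have sd: "(\<Sum>i<n. d i) = 1" using spec_trace[OF U] A'(3) by (metis of_real_eq_1_iff)
  have se: "(\<Sum>i<n. e i) = 1" using spec_trace[OF sB] B'(3) by (metis of_real_eq_1_iff)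
  have diagA: "Re (diag_in W A k) = (\<Sum>i<n. d i * Q i k)" if "k < n" for k
    using diag_in_overlap[OF U cW that] by (simp add: Q_def)
  have diagAA: "Re (diag_in W (A * A) k) = (\<Sum>i<n. d i * d i * Q i k)" if "k < n" for k
    using diag_in_overlap[OF spec_square[OF U] cW that] by (simp add: Q_def)
  \<comment> \<open>The kernel condition makes a whole column of nonnegative weights sum to zero, so
    the logarithm of a vanishing \<open>e k\<close> always carries weight zero.\<close>
  have z: "d i * Q i k = 0" if "i < n" "k < n" "e k = 0" for i k
  proof -
    have "diag_in W A k = 0" using le ker_le_iff_diag_in[OF A'(1) sB] that by blast
    then have "(\<Sum>i<n. d i * Q i k) = 0" using diagA[OF that(2)] by simp
    then show ?thesis using that d Q by (subst (asm) sum_nonneg_eq_0_iff) auto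
  qed
  have D: "log_tr A A - log_tr A B = (\<Sum>i<n. \<Sum>k<n. d i * Q i k * (ln_supp (d i) - ln_supp (e k)))"
  proof -
    have "log_tr A A = (\<Sum>i<n. d i * ln_supp (d i) * (\<Sum>k<n. Q i k))"
      unfolding log_tr_self[OF U] by (intro sum.cong) (auto simp: Qr)
    also have "\<dots> = (\<Sum>i<n. \<Sum>k<n. d i * Q i k * ln_supp (d i))"
      by (simp add: sum_distrib_left mult_ac)
    finally have 1: "log_tr A A = \<dots>" .
    have "log_tr A B = (\<Sum>k<n. \<Sum>i<n. d i * Q i k * ln_supp (e k))"
      unfolding log_tr_spec[OF A'(2) sB] by (intro sum.cong) (auto simp: diagA sum_distrib_right)
    also have "\<dots> = (\<Sum>i<n. \<Sum>k<n. d i * Q i k * ln_supp (e k))" by (rule sum.swap)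
    finally show ?thesis using 1 by (simp add: sum_subtractf right_diff_distrib)
  qed
  have lower: "d i * Q i k - e k * Q i k \<le> d i * Q i k * (ln_supp (d i) - ln_supp (e k))"
    and upper: "d i * Q i k * (ln_supp (d i) - ln_supp (e k)) \<le> d i * d i * Q i k / e k - d i * Q i k"
    if ik: "i < n" "k < n" for i k
  proof -
    have "d i * Q i k - e k * Q i k \<le> d i * Q i k * (ln_supp (d i) - ln_supp (e k)) \<and>
      d i * Q i k * (ln_supp (d i) - ln_supp (e k)) \<le> d i * d i * Q i k / e k - d i * Q i k"
    proof (cases "d i * Q i k = 0")
      case True
      have "d i * d i * Q i k = 0" using True by simp
      moreover have "0 \<le> e k * Q i k" using e[OF ik(2)] Q by simp
      moreover have "d i * d i * Q i k / e k = 0" "d i * Q i k * (ln_supp (d i) - ln_supp (e k)) = 0"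
        using True \<open>d i * d i * Q i k = 0\<close> by simp_all
      ultimately show ?thesis using True by linarith
    next
      case False
      then have pos: "0 < d i" "0 < Q i k" "0 < e k"
        using z[OF ik] d[OF ik(1)] Q[of i k] e[OF ik(2)] by (auto simp: less_le)
      have "ln (e k / d i) \<le> e k / d i - 1" "ln (d i / e k) \<le> d i / e k - 1"
        using pos by (intro ln_le_minus_one; simp)+
      then have b: "1 - e k / d i \<le> ln (d i) - ln (e k)" "ln (d i) - ln (e k) \<le> d i / e k - 1"
        using pos by (auto simp: ln_div)
      have "d i * Q i k * (1 - e k / d i) \<le> d i * Q i k * (ln (d i) - ln (e k))"
        "d i * Q i k * (ln (d i) - ln (e k)) \<le> d i * Q i k * (d i / e k - 1)"
        using b pos by (auto intro!: mult_left_mono)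
      moreover have "d i * Q i k * (1 - e k / d i) = d i * Q i k - e k * Q i k"
        using pos by (simp add: field_simps)
      moreover have "d i * Q i k * (d i / e k - 1) = d i * d i * Q i k / e k - d i * Q i k"
        using pos by (simp add: field_simps)
      ultimately show ?thesis using pos by (simp add: ln_supp_def)
    qed
    then show "d i * Q i k - e k * Q i k \<le> d i * Q i k * (ln_supp (d i) - ln_supp (e k))"
      "d i * Q i k * (ln_supp (d i) - ln_supp (e k)) \<le> d i * d i * Q i k / e k - d i * Q i k" by auto
  qed
  have dQ: "(\<Sum>i<n. \<Sum>k<n. d i * Q i k) = 1"
    using sd Qr by (simp add: sum_distrib_left[symmetric])
  have "(\<Sum>i<n. \<Sum>k<n. e k * Q i k) = (\<Sum>k<n. \<Sum>i<n. e k * Q i k)" by (rule sum.swap)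
  then have eQ: "(\<Sum>i<n. \<Sum>k<n. e k * Q i k) = 1"
    using se Qc by (simp add: sum_distrib_left[symmetric])
  \<comment> \<open>Both joint distributions have total mass one, so the termwise lower bounds add
    up to zero.\<close>
  have "0 = (\<Sum>i<n. \<Sum>k<n. d i * Q i k - e k * Q i k)"
    using dQ eQ by (simp add: sum_subtractf)
  also have "\<dots> \<le> log_tr A A - log_tr A B"
    unfolding D using lower by (intro sum_mono) auto
  finally show "0 \<le> log_tr A A - log_tr A B" .
  have "log_tr A A - log_tr A B \<le> (\<Sum>i<n. \<Sum>k<n. d i * d i * Q i k / e k - d i * Q i k)"
    unfolding D using upper by (intro sum_mono) auto
  also have "\<dots> = (\<Sum>i<n. \<Sum>k<n. d i * d i * Q i k / e k) - 1"
    using dQ by (simp add: sum_subtractf)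
  also have "(\<Sum>i<n. \<Sum>k<n. d i * d i * Q i k / e k) = (\<Sum>k<n. \<Sum>i<n. d i * d i * Q i k / e k)"
    by (rule sum.swap)
  also have "\<dots> = (\<Sum>k<n. Re (diag_in W (A * A) k) / e k)"
    by (intro sum.cong) (auto simp: diagAA sum_divide_distrib)
  finally show "log_tr A A - log_tr A B \<le> (\<Sum>k<n. Re (diag_in W (A * A) k) / e k) - 1" .
qed

definition mix :: "real \<Rightarrow> complex mat \<Rightarrow> complex mat \<Rightarrow> complex mat" where
  "mix p A B = complex_of_real p \<cdot>\<^sub>m A + complex_of_real (1 - p) \<cdot>\<^sub>m B"

lemma density_mix:
  assumes "density n A" "density n B" "0 \<le> p" "p \<le> 1"
  shows "density n (mix p A B)"
  using densityD[OF assms(1)] densityD[OF assms(2)] assms(3,4)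
  by (auto simp: density_def mix_def mat_trace_add[of _ n] mat_trace_smult[of _ n]
      simp del: of_real_diff intro!: psd_add psd_smult) simp

lemma smult_zero_vec: "(c :: complex) \<cdot>\<^sub>v 0\<^sub>v n = 0\<^sub>v n"
  by (intro eq_vecI) auto

lemma smult_mat_mult_vec:
  fixes A :: "complex mat"
  assumes "A \<in> carrier_mat m n" "v \<in> carrier_vec n"
  shows "(c \<cdot>\<^sub>m A) *\<^sub>v v = c \<cdot>\<^sub>v (A *\<^sub>v v)"
  using assms by (intro eq_vecI) auto

text \<open>The mixture is \<open>B\<close> plus \<open>p\<close> times the traceless difference of
  \<open>A\<close> and \<open>B\<close>. The chi-square expression is quadratic in it, and its
  linear part is proportional to the trace of the difference, so exactly a multiple of
  \<open>p\<^sup>2\<close> is left. The factor is the chi-square divergence of \<open>A\<close> from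
  \<open>B\<close>.\<close>

lemma rel_entropy_mix_bound:
  assumes A: "density n A" and B: "density n B" and le: "ker_le n B A"
  shows "\<exists>K. \<forall>p. 0 \<le> p \<longrightarrow> p \<le> 1 \<longrightarrow>
    0 \<le> log_tr (mix p A B) (mix p A B) - log_tr (mix p A B) B \<and>
    log_tr (mix p A B) (mix p A B) - log_tr (mix p A B) B \<le> K * p\<^sup>2"
proof -
  note A' = densityD[OF A] and B' = densityD[OF B]
  obtain W e where sB: "spec n B W e" by (rule psdE[OF B'(1)]) blast
  have w: "unitary n W" using sB by (simp add: spec_def)
  note cW = unitaryD(1)[OF w]
  \<comment> \<open>The trace of the square of \<open>A\<close> against the pseudo-inverse of
    \<open>B\<close>; it does not depend on \<open>p\<close>, and \<open>R - 1\<close> is the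
    constant \<open>K\<close>.\<close>
  define R where "R = (\<Sum>k<n. Re (diag_in W (A * A) k) / e k)"
  have "0 \<le> log_tr (mix p A B) (mix p A B) - log_tr (mix p A B) B \<and>
    log_tr (mix p A B) (mix p A B) - log_tr (mix p A B) B \<le> (R - 1) * p\<^sup>2"
    if p: "0 \<le> p" "p \<le> 1" for p
  proof -
    let ?T = "mix p A B"
    have T: "density n ?T" using density_mix[OF A B p] .
    have leT: "ker_le n B ?T"
      unfolding ker_le_def
    proof (intro ballI impI)
      fix v assume v: "v \<in> carrier_vec n" "B *\<^sub>v v = 0\<^sub>v n"
      then have "A *\<^sub>v v = 0\<^sub>v n" using le by (auto simp: ker_le_def)
      then show "?T *\<^sub>v v = 0\<^sub>v n"
        using v A'(2) B'(2) by (simp add: mix_def add_mult_distrib_mat_vec[of _ n n] smult_mat_mult_vec[of _ n n] smult_zero_vec)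
    qed
    have z: "diag_in W A k = 0" if "k < n" "e k = 0" for k
      using le ker_le_iff_diag_in[OF A'(1) sB] that by blast
    let ?p = "complex_of_real p" and ?q = "complex_of_real (1 - p)"
    have TT: "?T * ?T = (?p * ?p) \<cdot>\<^sub>m (A * A) + (?p * ?q) \<cdot>\<^sub>m (A * B) + ((?q * ?p) \<cdot>\<^sub>m (B * A) + (?q * ?q) \<cdot>\<^sub>m (B * B))"
    proof -
      have c: "A * A \<in> carrier_mat n n" "A * B \<in> carrier_mat n n" "B * A \<in> carrier_mat n n" "B * B \<in> carrier_mat n n"
        using A'(2) B'(2) by auto
      have "?T * ?T = (?p \<cdot>\<^sub>m A) * ?T + (?q \<cdot>\<^sub>m B) * ?T"
        unfolding mix_def using A'(2) B'(2) by (intro add_mult_distrib_mat[of _ n n]) auto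
      also have "(?p \<cdot>\<^sub>m A) * ?T = (?p * ?p) \<cdot>\<^sub>m (A * A) + (?p * ?q) \<cdot>\<^sub>m (A * B)"
        unfolding mix_def using A'(2) B'(2)
        by (subst mult_add_distrib_mat[of _ n n])
           (auto simp: mult_smult_assoc_mat[of _ n n] mult_smult_distrib[of _ n n] smult_smult_mat simp del: of_real_diff)
      also have "(?q \<cdot>\<^sub>m B) * ?T = (?q * ?p) \<cdot>\<^sub>m (B * A) + (?q * ?q) \<cdot>\<^sub>m (B * B)"
        unfolding mix_def using A'(2) B'(2)
        by (subst mult_add_distrib_mat[of _ n n])
           (auto simp: mult_smult_assoc_mat[of _ n n] mult_smult_distrib[of _ n n] smult_smult_mat simp del: of_real_diff)
      finally show ?thesis .
    qed
    \<comment> \<open>Each cross term contains a factor \<open>e k\<close>, which the division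
      cancels. If \<open>e k = 0\<close>, the quotients are 0 by convention and \<open>z\<close>
      removes the middle term, so both sides vanish.\<close>
    have "Re (diag_in W (?T * ?T) k) / e k
        = p\<^sup>2 * (Re (diag_in W (A * A) k) / e k) + 2 * p * (1 - p) * Re (diag_in W A k) + (1 - p)\<^sup>2 * e k"
      if k: "k < n" for k
    proof -
      have c: "A * A \<in> carrier_mat n n" "A * B \<in> carrier_mat n n" "B * A \<in> carrier_mat n n" "B * B \<in> carrier_mat n n"
        using A'(2) B'(2) by auto
      have eq: "diag_in W (?T * ?T) k = ?p * ?p * diag_in W (A * A) k + ?p * ?q * (complex_of_real (e k) * diag_in W A k)
          + (?q * ?p * (complex_of_real (e k) * diag_in W A k) + ?q * ?q * (complex_of_real (e k) * complex_of_real (e k)))"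
        unfolding TT using c k
        by (simp add: diag_in_add[OF _ _ cW k] diag_in_smult[OF _ cW k] diag_in_spec_mult[OF sB _ k] A'(2) B'(2)
            spec_diag_in[OF sB k] del: of_real_diff)
      have "Re (diag_in W (?T * ?T) k) = p\<^sup>2 * Re (diag_in W (A * A) k)
          + 2 * p * (1 - p) * (e k * Re (diag_in W A k)) + (1 - p)\<^sup>2 * (e k * e k)"
        unfolding eq by (simp del: of_real_diff) (simp add: power2_eq_square algebra_simps)
      then show ?thesis using z[OF k] by (cases "e k = 0") (auto simp: field_simps)
    qed
    then have "(\<Sum>k<n. Re (diag_in W (?T * ?T) k) / e k)
        = p\<^sup>2 * R + 2 * p * (1 - p) * (\<Sum>k<n. Re (diag_in W A k)) + (1 - p)\<^sup>2 * (\<Sum>k<n. e k)"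
      by (simp add: R_def sum.distrib sum_distrib_left)
    moreover have "(\<Sum>k<n. Re (diag_in W A k)) = 1"
      using sum_diag_in[OF A'(2) w] A'(3) by (simp flip: Re_sum)
    moreover have "(\<Sum>k<n. e k) = 1" using spec_trace[OF sB] B'(3) by (metis of_real_eq_1_iff)
    \<comment> \<open>With traces one, the sum is p^2 R + 2 p (1 - p) + (1 - p)^2; subtracting 1
      leaves (R - 1) p^2.\<close>
    ultimately have "(\<Sum>k<n. Re (diag_in W (?T * ?T) k) / e k) - 1 = (R - 1) * p\<^sup>2"
      by (simp add: power2_eq_square algebra_simps)
    then show ?thesis using rel_entropy_bounds[OF T B sB leT] by simp
  qed
  then show ?thesis by blast
qed

section \<open>Channels and flag states\<close>

lemma extend_carrier [simp]: "extend k n n' N X \<in> carrier_mat (k * n') (k * n')"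
  by (simp add: extend_def)

lemma mat_block_carrier [simp]: "mat_block n X i j \<in> carrier_mat n n"
  by (simp add: mat_block_def)

lemma extend_index:
  assumes "i < k" "j < k" "p < n'" "q < n'"
  shows "extend k n n' N X $$ (i * n' + p, j * n' + q) = N (mat_block n X i j) $$ (p, q)"
  using assms by (simp add: extend_def block_index_less div_mod_block)

lemma eq_mat_blocksI:
  assumes "A \<in> carrier_mat (k * n) (k * n)" "B \<in> carrier_mat (k * n) (k * n)"
    and "\<And>i j p q. i < k \<Longrightarrow> j < k \<Longrightarrow> p < n \<Longrightarrow> q < n \<Longrightarrow>
      A $$ (i * n + p, j * n + q) = B $$ (i * n + p, j * n + q)"
  shows "A = B"
proof (rule eq_matI)
  fix i j assume "i < dim_row B" "j < dim_col B"
  then have ij: "i < k * n" "j < k * n" using assms(2) by auto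
  show "A $$ (i, j) = B $$ (i, j)"
    using assms(3)[OF div_mod_less(1)[OF ij(1)] div_mod_less(1)[OF ij(2)]
      div_mod_less(2)[OF ij(1)] div_mod_less(2)[OF ij(2)]] by simp
qed (use assms in auto)

lemma linear_mapD:
  assumes "linear_map n n' N"
  shows "X \<in> carrier_mat n n \<Longrightarrow> N X \<in> carrier_mat n' n'"
    and "X \<in> carrier_mat n n \<Longrightarrow> Y \<in> carrier_mat n n \<Longrightarrow> N (X + Y) = N X + N Y"
    and "X \<in> carrier_mat n n \<Longrightarrow> N (c \<cdot>\<^sub>m X) = c \<cdot>\<^sub>m N X"
    and "N (0\<^sub>m n n) = 0\<^sub>m n' n'"
proof -
  show 1: "X \<in> carrier_mat n n \<Longrightarrow> N X \<in> carrier_mat n' n'" for X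
    using assms by (auto simp: linear_map_def)
  show "X \<in> carrier_mat n n \<Longrightarrow> Y \<in> carrier_mat n n \<Longrightarrow> N (X + Y) = N X + N Y"
    using assms by (auto simp: linear_map_def)
  show sm: "X \<in> carrier_mat n n \<Longrightarrow> N (c \<cdot>\<^sub>m X) = c \<cdot>\<^sub>m N X" for X c
    using assms by (auto simp: linear_map_def)
  have "0\<^sub>m n n = (0 :: complex) \<cdot>\<^sub>m 0\<^sub>m n n" by (intro eq_matI) auto
  then have "N (0\<^sub>m n n) = 0 \<cdot>\<^sub>m N (0\<^sub>m n n)" using sm[of "0\<^sub>m n n" 0] by simp
  then show "N (0\<^sub>m n n) = 0\<^sub>m n' n'" using 1[of "0\<^sub>m n n"] by (intro eq_matI) (auto, metis index_smult_mat(1) mult_zero_left carrier_matD)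
qed

lemma extend_add:
  assumes N: "linear_map n n' N" and X: "X \<in> carrier_mat (k * n) (k * n)" "Y \<in> carrier_mat (k * n) (k * n)"
  shows "extend k n n' N (X + Y) = extend k n n' N X + extend k n n' N Y"
proof (rule eq_mat_blocksI[of _ k n'])
  fix i j p q assume l: "i < k" "j < k" "p < n'" "q < n'"
  have "mat_block n (X + Y) i j = mat_block n X i j + mat_block n Y i j"
    using X l by (intro eq_matI) (auto simp: mat_block_def block_index_less)
  then show "extend k n n' N (X + Y) $$ (i * n' + p, j * n' + q)
      = (extend k n n' N X + extend k n n' N Y) $$ (i * n' + p, j * n' + q)"
    using l linear_mapD(1)[OF N mat_block_carrier] carrier_matD[OF extend_carrier]
    by (simp add: extend_index linear_mapD[OF N] block_index_less carrier_matD[OF linear_mapD(1)[OF N mat_block_carrier]])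
qed auto

lemma extend_smult:
  assumes N: "linear_map n n' N" and X: "X \<in> carrier_mat (k * n) (k * n)"
  shows "extend k n n' N (c \<cdot>\<^sub>m X) = c \<cdot>\<^sub>m extend k n n' N X"
proof (rule eq_mat_blocksI[of _ k n'])
  fix i j p q assume l: "i < k" "j < k" "p < n'" "q < n'"
  have "mat_block n (c \<cdot>\<^sub>m X) i j = c \<cdot>\<^sub>m mat_block n X i j"
    using X l by (intro eq_matI) (auto simp: mat_block_def block_index_less)
  then show "extend k n n' N (c \<cdot>\<^sub>m X) $$ (i * n' + p, j * n' + q)
      = (c \<cdot>\<^sub>m extend k n n' N X) $$ (i * n' + p, j * n' + q)"
    using l carrier_matD[OF extend_carrier]
    by (simp add: extend_index linear_mapD[OF N] block_index_less carrier_matD[OF linear_mapD(1)[OF N mat_block_carrier]])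
qed auto

lemma marg_fst_extend:
  assumes N: "linear_map n n' N" "trace_preserving n N" and X: "X \<in> carrier_mat (k * n) (k * n)"
  shows "marg_fst k n' (extend k n n' N X) = marg_fst k n X"
proof (rule eq_matI)
  fix i j assume "i < dim_row (marg_fst k n X)" "j < dim_col (marg_fst k n X)"
  then have ij: "i < k" "j < k" by (auto simp: marg_fst_def)
  have "marg_fst k n' (extend k n n' N X) $$ (i, j) = mat_trace (N (mat_block n X i j))"
    using ij carrier_matD[OF linear_mapD(1)[OF N(1) mat_block_carrier]]
    by (simp add: marg_fst_def mat_trace_def extend_index)
  also have "\<dots> = mat_trace (mat_block n X i j)" using N(2) by (simp add: trace_preserving_def)
  also have "\<dots> = marg_fst k n X $$ (i, j)"
    using ij by (simp add: marg_fst_def mat_trace_def mat_block_def)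
  finally show "marg_fst k n' (extend k n n' N X) $$ (i, j) = marg_fst k n X $$ (i, j)" .
qed (auto simp: marg_fst_def)

text \<open>The marginal on the second factor is the sum of the diagonal blocks, so linearity
  suffices. The induction runs over the number \<open>m\<close> of summed blocks, starting at the
  zero matrix.\<close>

lemma marg_snd_extend:
  assumes N: "linear_map n n' N" and X: "X \<in> carrier_mat (k * n) (k * n)"
  shows "marg_snd k n' (extend k n n' N X) = N (marg_snd k n X)"
proof -
  have sum: "N (marg_snd m n X) $$ (p, q) = (\<Sum>i<m. N (mat_block n X i i) $$ (p, q))"
    if "p < n'" "q < n'" for m p q
  proof (induction m)
    case 0
    have "marg_snd 0 n X = 0\<^sub>m n n" by (intro eq_matI) (auto simp: marg_snd_def)
    then show ?case using that by (simp add: linear_mapD(4)[OF N])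
  next
    case (Suc m)
    have "marg_snd (Suc m) n X = marg_snd m n X + mat_block n X m m"
      by (intro eq_matI) (auto simp: marg_snd_def mat_block_def)
    then show ?case
      using that Suc carrier_matD[OF linear_mapD(1)[OF N mat_block_carrier]]
      by (simp add: linear_mapD(2)[OF N])
  qed
  show ?thesis
    by (rule eq_matI)
       (auto simp: marg_snd_def[of k n'] extend_index sum carrier_matD[OF linear_mapD(1)[OF N marg_carrier(2)]])
qed

lemma density_extend:
  assumes N: "channel n n' N" and X: "density (k * n) X"
  shows "density (k * n') (extend k n n' N X)"
proof -
  have "mat_trace (extend k n n' N X) = 1"
    using N X mat_trace_marg(1)[OF extend_carrier[of k n n' N X]] mat_trace_marg(1)[of X k n]
    by (simp add: marg_fst_extend densityD channel_def)
  then show ?thesis using N X by (auto simp: density_def channel_def completely_positive_def)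
qed

text \<open>Complete positivity speaks only about \<open>extend\<close>, so a one-dimensional
  ancilla is attached and then traced out; this reduces the claim to
  \<open>density_extend\<close>.\<close>

lemma density_channel:
  assumes N: "channel n n' N" and X: "density n X"
  shows "density n' (N X)"
proof -
  have "density 1 (1\<^sub>m 1)"
  proof -
    have "spec 1 (1\<^sub>m 1) (1\<^sub>m 1) (\<lambda>_. 1)" by (simp add: spec_def unitary_one)
    then have "psd 1 (1\<^sub>m 1)" by (rule spec_psd) simp
    then show ?thesis by (simp add: density_def mat_trace_def)
  qed
  then have d: "density (1 * n) (1\<^sub>m 1 \<otimes>\<^sub>m X)" using X by (rule density_tensor)
  have "marg_snd 1 n (1\<^sub>m 1 \<otimes>\<^sub>m X) = X"
    using marg_tensor(2)[of "1\<^sub>m 1" 1 X n] densityD(2)[OF X] by (simp add: mat_trace_def)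
  then have "marg_snd 1 n' (extend 1 n n' N (1\<^sub>m 1 \<otimes>\<^sub>m X)) = N X"
    using marg_snd_extend[of n n' N _ 1] N densityD(2)[OF d] by (simp add: channel_def)
  then show ?thesis using density_marg(2)[OF density_extend[OF N d]] by simp
qed

section \<open>Operator domination and the kernel condition under channels\<close>

lemma sum_squared_le:
  fixes a :: "nat \<Rightarrow> real"
  shows "(\<Sum>k<n. a k)\<^sup>2 \<le> real n * (\<Sum>k<n. (a k)\<^sup>2)"
proof -
  let ?s = "\<Sum>k<n. a k" and ?q = "\<Sum>k<n. (a k)\<^sup>2"
  \<comment> \<open>Cauchy-Schwarz against the constant vector: the difference of the two sides is
    half of this double sum.\<close>
  have "0 \<le> (\<Sum>i<n. \<Sum>j<n. (a i - a j)\<^sup>2)" by (intro sum_nonneg) auto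
  also have "\<dots> = (\<Sum>i<n. real n * (a i)\<^sup>2 + ?q - 2 * a i * ?s)"
    by (intro sum.cong) (auto simp: power2_diff sum.distrib sum_subtractf sum_distrib_left)
  also have "\<dots> = 2 * (real n * ?q) - 2 * ?s\<^sup>2"
    by (simp add: sum.distrib sum_subtractf sum_distrib_left[symmetric] sum_distrib_right[symmetric] power2_eq_square)
  finally show ?thesis by simp
qed

lemma cmod_sum_squared_le:
  "(cmod (\<Sum>k<n. z k))\<^sup>2 \<le> real n * (\<Sum>k<n. (cmod (z k))\<^sup>2)"
proof -
  have "(cmod (\<Sum>k<n. z k))\<^sup>2 \<le> (\<Sum>k<n. cmod (z k))\<^sup>2"
    by (intro power_mono norm_sum) auto
  also have "\<dots> \<le> real n * (\<Sum>k<n. (cmod (z k))\<^sup>2)"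
    by (rule sum_squared_le)
  finally show ?thesis .
qed

lemma psd_form_diff:
  fixes A B :: "complex mat"
  assumes "A \<in> carrier_mat n n" "B \<in> carrier_mat n n" "v \<in> carrier_vec n"
  shows "((c \<cdot>\<^sub>m B + (- 1) \<cdot>\<^sub>m A) *\<^sub>v v) \<bullet>c v = c * ((B *\<^sub>v v) \<bullet>c v) - (A *\<^sub>v v) \<bullet>c v"
  using assms
  by (simp add: add_mult_distrib_mat_vec[of _ n n] smult_mat_mult_vec[of _ n n] add_scalar_prod_distrib[of _ n]
      smult_scalar_prod_distrib[of _ n])

text \<open>Replaces a statement about kernels by an inequality that positive maps preserve. The
  difference is written as a linear combination so that \<open>extend_add\<close> and
  \<open>extend_smult\<close> apply to it.\<close>

lemma ker_le_imp_dominated: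
  assumes A: "psd n A" and B: "psd n B" and le: "ker_le n B A"
  shows "\<exists>c. psd n (complex_of_real c \<cdot>\<^sub>m B + (- 1) \<cdot>\<^sub>m A)"
proof -
  obtain U d where U: "spec n A U d" and d: "\<And>i. i < n \<Longrightarrow> 0 \<le> d i" by (rule psdE[OF A]) blast
  obtain W e where W: "spec n B W e" and e: "\<And>i. i < n \<Longrightarrow> 0 \<le> e i" by (rule psdE[OF B]) blast
  have u: "unitary n U" "unitary n W" using U W by (auto simp: spec_def)
  note cU = unitaryD[OF u(1)] and cW = unitaryD[OF u(2)]
  have cA: "A \<in> carrier_mat n n" "B \<in> carrier_mat n n" "hermitian A" "hermitian B"
    using A B by (auto simp: psd_def)
  have z: "d i * overlap U W i k = 0" if "i < n" "k < n" "e k = 0" for i k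
  proof -
    have "diag_in W A k = 0" using le ker_le_iff_diag_in[OF A W] that by blast
    then have "(\<Sum>i<n. d i * overlap U W i k) = 0"
      unfolding diag_in_overlap[OF U cW(1) that(2)] by (metis of_real_eq_0_iff)
    then show ?thesis using that d by (subst (asm) sum_nonneg_eq_0_iff) auto
  qed
  \<comment> \<open>Indices with \<open>e k = 0\<close> contribute nothing, as \<open>x / 0 = 0\<close>; they are handled by the kernel condition.\<close>
  define c where "c = (\<Sum>k<n. \<Sum>i<n. real n * d i * overlap U W i k / e k)"
  have ck: "(\<Sum>i<n. real n * d i * overlap U W i k) \<le> c * e k" if k: "k < n" for k
  proof (cases "e k = 0")
    case True
    then have "(\<Sum>i<n. real n * d i * overlap U W i k) = 0" using z k by (intro sum.neutral) auto
    then show ?thesis using True by simp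
  next
    case False
    \<comment> \<open>\<open>c\<close> adds nonnegative ratios over all \<open>k\<close>, hence
      bounds each of them.\<close>
    have "(\<Sum>i<n. real n * d i * overlap U W i k / e k) \<le> c"
      unfolding c_def
      by (rule member_le_sum[of k "{..<n}" "\<lambda>k. \<Sum>i<n. real n * d i * overlap U W i k / e k"])
         (use k d e in \<open>auto intro!: sum_nonneg divide_nonneg_nonneg mult_nonneg_nonneg\<close>)
    then show ?thesis using False e[OF k] by (simp add: sum_divide_distrib[symmetric] pos_divide_le_eq less_le)
  qed
  have form: "0 \<le> ((complex_of_real c \<cdot>\<^sub>m B + (- 1) \<cdot>\<^sub>m A) *\<^sub>v v) \<bullet>c v" if v: "v \<in> carrier_vec n" for v
  proof -
    define x where "x = mat_adjoint U *\<^sub>v v"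
    define y where "y = mat_adjoint W *\<^sub>v v"
    have y: "y \<in> carrier_vec n" using cW(2) v by (simp add: y_def)
    have "(mat_adjoint U * W) *\<^sub>v y = mat_adjoint U *\<^sub>v ((W * mat_adjoint W) *\<^sub>v v)"
      unfolding y_def using cU(2) cW(1,2) v
      by (simp only: assoc_mult_mat_vec[of _ n n _ n] mult_carrier_mat[of _ n n] mult_mat_vec_carrier[of _ n n])
    then have xy: "x = (mat_adjoint U * W) *\<^sub>v y" using cW(5) v by (simp add: x_def)
    \<comment> \<open>The coordinates of \<open>v\<close> in the two eigenbases are related by a
      unitary; bounding the square of a sum of \<open>n\<close> terms produces the factor
      \<open>real n\<close> in \<open>c\<close>.\<close>
    have xi: "(cmod (x $ i))\<^sup>2 \<le> real n * (\<Sum>k<n. overlap U W i k * (cmod (y $ k))\<^sup>2)" if i: "i < n" for i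
    proof -
      have "x $ i = (\<Sum>k<n. (mat_adjoint U * W) $$ (i, k) * y $ k)"
        unfolding xy using i y cU(1,2) cW(1)
        by (subst index_mult_mat_vec) (simp_all add: scalar_prod_def atLeast0LessThan)
      then show ?thesis
        using cmod_sum_squared_le[of "\<lambda>k. (mat_adjoint U * W) $$ (i, k) * y $ k" n]
        by (simp add: overlap_def norm_mult power_mult_distrib)
    qed
    have "(\<Sum>i<n. d i * (cmod (x $ i))\<^sup>2)
        \<le> (\<Sum>i<n. d i * (real n * (\<Sum>k<n. overlap U W i k * (cmod (y $ k))\<^sup>2)))"
      using xi d by (intro sum_mono mult_left_mono) auto
    also have "\<dots> = (\<Sum>i<n. \<Sum>k<n. real n * d i * overlap U W i k * (cmod (y $ k))\<^sup>2)"
      by (simp add: sum_distrib_left mult_ac)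
    also have "\<dots> = (\<Sum>k<n. \<Sum>i<n. real n * d i * overlap U W i k * (cmod (y $ k))\<^sup>2)"
      by (rule sum.swap)
    also have "\<dots> \<le> (\<Sum>k<n. c * e k * (cmod (y $ k))\<^sup>2)"
      unfolding sum_distrib_right[symmetric] using ck by (intro sum_mono mult_right_mono) auto
    finally have "(\<Sum>i<n. d i * (cmod (x $ i))\<^sup>2) \<le> c * (\<Sum>k<n. e k * (cmod (y $ k))\<^sup>2)"
      by (simp add: sum_distrib_left mult.assoc)
    then show ?thesis
      unfolding psd_form_diff[OF cA(1,2) v] spec_form[OF U v] spec_form[OF W v] x_def[symmetric] y_def[symmetric]
      by (simp only: of_real_mult[symmetric] of_real_diff[symmetric] complex_of_real_nonneg_iff)
  qed
  have "hermitian (complex_of_real c \<cdot>\<^sub>m B + (- 1) \<cdot>\<^sub>m A)"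
    using hermitian_add[where n = n, OF _ _ spec_hermitian[OF spec_smult[OF W, of c]] spec_hermitian[OF spec_smult[OF U, of "- 1"]]] cA
    by simp
  then show ?thesis using form cA by (intro exI[of _ c]) (auto simp: psd_def)
qed

text \<open>On the kernel of \<open>B\<close> the inequality says that the quadratic form of
  \<open>A\<close> is at most 0, and positivity of \<open>A\<close> gives the converse.\<close>

lemma dominated_imp_ker_le:
  assumes A: "psd n A" and B: "B \<in> carrier_mat n n" and le: "psd n (c \<cdot>\<^sub>m B + (- 1) \<cdot>\<^sub>m A)"
  shows "ker_le n B A"
  unfolding ker_le_def
proof (intro ballI impI)
  fix v assume v: "v \<in> carrier_vec n" "B *\<^sub>v v = 0\<^sub>v n"
  have cA: "A \<in> carrier_mat n n" using A by (simp add: psd_def)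
  have "0 \<le> c * ((B *\<^sub>v v) \<bullet>c v) - (A *\<^sub>v v) \<bullet>c v"
    using le v(1) psd_form_diff[OF cA B v(1)] by (metis psd_def)
  moreover have "0 \<le> (A *\<^sub>v v) \<bullet>c v" using A v(1) by (auto simp: psd_def)
  ultimately have "(A *\<^sub>v v) \<bullet>c v = 0" using v by (auto simp: less_eq_complex_def complex_eq_iff)
  then show "A *\<^sub>v v = 0\<^sub>v n" by (rule psd_form_eq_0[OF A v(1)])
qed

text \<open>Guarantees that a finite relative entropy stays finite after the channel, so that the
  numerator of the ratio is a real number.\<close>

lemma ker_le_extend:
  assumes N: "channel n n' N" and A: "psd (k * n) A" and B: "psd (k * n) B" and le: "ker_le (k * n) B A"
  shows "ker_le (k * n') (extend k n n' N B) (extend k n n' N A)"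
proof -
  have lin: "linear_map n n' N" and cp: "completely_positive n n' N" using N by (auto simp: channel_def)
  have cA: "A \<in> carrier_mat (k * n) (k * n)" "B \<in> carrier_mat (k * n) (k * n)" using A B by (auto simp: psd_def)
  obtain c where c: "psd (k * n) (complex_of_real c \<cdot>\<^sub>m B + (- 1) \<cdot>\<^sub>m A)"
    using ker_le_imp_dominated[OF A B le] by blast
  have "psd (k * n') (extend k n n' N (complex_of_real c \<cdot>\<^sub>m B + (- 1) \<cdot>\<^sub>m A))"
    "psd (k * n') (extend k n n' N A)" using cp c A by (auto simp: completely_positive_def)
  then show ?thesis
    using cA by (intro dominated_imp_ker_le[of _ _ _ "complex_of_real c"])
      (simp_all add: extend_add[OF lin] extend_smult[OF lin])
qed

section \<open>Direct sums as flag states, and the action of channels on them\<close>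

lemma dsum_block_index:
  assumes A: "A \<in> carrier_mat (r * n) (r * n)" "B \<in> carrier_mat (r * n) (r * n)"
    and ij: "i < r + r" "j < r + r" and pq: "p < n" "q < n"
  shows "dsum A B $$ (i * n + p, j * n + q) =
    (if i < r \<and> j < r then A $$ (i * n + p, j * n + q)
     else if \<not> i < r \<and> \<not> j < r then B $$ ((i - r) * n + p, (j - r) * n + q) else 0)"
proof -
  have l: "i * n + p < (r + r) * n" "j * n + q < (r + r) * n"
    using ij pq by (auto intro!: block_index_less)
  \<comment> \<open>Reconciles two index schemes: the direct sum splits indices at
    \<open>r * n\<close>, which lies on a block boundary, so the split depends only on the block
    number.\<close>
  have lt: "i' * n + p' < r * n \<longleftrightarrow> i' < r" if "p' < n" for i' p'
  proof
    assume "i' * n + p' < r * n"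
    then have "i' * n < r * n" by linarith
    then show "i' < r" by simp
  qed (use that block_index_less in auto)
  have sub: "i' * n + p' - r * n = (i' - r) * n + p'" if "\<not> i' < r" for i' p'
    using that by (simp add: diff_mult_distrib)
  show ?thesis
    using A l pq by (auto simp: index_dsum lt sub add_mult_distrib)
qed

lemma marg_dsum:
  assumes A: "A \<in> carrier_mat (r * n) (r * n)" "B \<in> carrier_mat (r * n) (r * n)"
  shows "marg_fst (r + r) n (dsum A B) = dsum (marg_fst r n A) (marg_fst r n B)"
    and "marg_snd (r + r) n (dsum A B) = marg_snd r n A + marg_snd r n B"
proof -
  note ix = dsum_block_index[OF A]
  show "marg_fst (r + r) n (dsum A B) = dsum (marg_fst r n A) (marg_fst r n B)"
    by (rule eq_matI) (auto simp: marg_fst_def ix index_dsum)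
  show "marg_snd (r + r) n (dsum A B) = marg_snd r n A + marg_snd r n B"
    by (rule eq_matI) (auto simp: marg_snd_def ix sum_split_lessThan)
qed

lemma extend_dsum:
  assumes N: "linear_map n n' N" and A: "A \<in> carrier_mat (r * n) (r * n)" "B \<in> carrier_mat (r * n) (r * n)"
  shows "extend (r + r) n n' N (dsum A B) = dsum (extend r n n' N A) (extend r n n' N B)"
proof (rule eq_mat_blocksI[of _ "r + r" n'])
  fix i j p q assume l: "i < r + r" "j < r + r" "p < n'" "q < n'"
  have "mat_block n (dsum A B) i j = (if i < r \<and> j < r then mat_block n A i j
      else if \<not> i < r \<and> \<not> j < r then mat_block n B (i - r) (j - r) else 0\<^sub>m n n)"
    using l by (intro eq_matI) (auto simp: mat_block_def dsum_block_index[OF A])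
  then show "extend (r + r) n n' N (dsum A B) $$ (i * n' + p, j * n' + q)
      = dsum (extend r n n' N A) (extend r n n' N B) $$ (i * n' + p, j * n' + q)"
    using l by (auto simp: extend_index dsum_block_index[OF extend_carrier extend_carrier] linear_mapD(4)[OF N])
qed (use extend_carrier[of "r + r" n n' N] in \<open>auto simp: add_mult_distrib intro!: dsum_carrier\<close>)

text \<open>The flag states \<open>\<omega>\<^sub>p\<close>.  Since the flag is the leading tensor factor, they are block
  diagonal, and the system \<open>C\<close> has dimension \<open>r + r\<close>.\<close>

definition flag :: "nat \<Rightarrow> nat \<Rightarrow> real \<Rightarrow> complex mat \<Rightarrow> complex mat \<Rightarrow> complex mat" where
  "flag r n p X S = dsum (complex_of_real p \<cdot>\<^sub>m X) (complex_of_real (1 - p) \<cdot>\<^sub>m (marg_fst r n X \<otimes>\<^sub>m S))"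

text \<open>The channel sends the product in the second branch to a product, and by trace
  preservation the marginal on R that defines this branch is the same before and after.\<close>

lemma extend_flag:
  assumes N: "channel n n' N" and X: "X \<in> carrier_mat (r * n) (r * n)" and S: "S \<in> carrier_mat n n"
  shows "extend (r + r) n n' N (flag r n p X S) = flag r n' p (extend r n n' N X) (N S)"
proof -
  have lin: "linear_map n n' N" "trace_preserving n N" using N by (auto simp: channel_def)
  have t: "marg_fst r n X \<otimes>\<^sub>m S \<in> carrier_mat (r * n) (r * n)" using tensor_carrier[OF marg_carrier(1) S] .
  show ?thesis
    using X t unfolding flag_def
    by (simp add: extend_dsum[OF lin(1)] extend_smult[OF lin(1)] extend_tensor[OF lin(1) marg_carrier(1) S]
        marg_fst_extend[OF lin] del: of_real_diff)
qed

lemma density_flag: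
  assumes X: "density (r * n) X" and S: "density n S" and p: "0 \<le> p" "p \<le> 1"
  shows "density ((r + r) * n) (flag r n p X S)"
proof -
  have Y: "density (r * n) (marg_fst r n X \<otimes>\<^sub>m S)" using density_tensor[OF density_marg(1)[OF X] S] .
  have "psd (r * n + r * n) (flag r n p X S)"
    unfolding flag_def using densityD(1)[OF X] densityD(1)[OF Y] p by (intro psd_dsum psd_smult) auto
  moreover have td: "mat_trace (dsum A B) = mat_trace A + mat_trace B"
    if "A \<in> carrier_mat k k" "B \<in> carrier_mat k k" for A B k
    using that by (simp add: mat_trace_def sum_split_lessThan index_dsum)
  have "mat_trace (flag r n p X S) = mat_trace (complex_of_real p \<cdot>\<^sub>m X)
      + mat_trace (complex_of_real (1 - p) \<cdot>\<^sub>m (marg_fst r n X \<otimes>\<^sub>m S))"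
    unfolding flag_def by (rule td[of _ "r * n"]) (use densityD(2)[OF X] densityD(2)[OF Y] in auto)
  then have "mat_trace (flag r n p X S) = 1"
    using mat_trace_smult[OF densityD(2)[OF X]] mat_trace_smult[OF densityD(2)[OF Y]]
      densityD(3)[OF X] densityD(3)[OF Y] by simp
  ultimately show ?thesis by (simp add: density_def add_mult_distrib)
qed

section \<open>Mutual information of the flag states and its limit\<close>

lemma mutual_info_eq:
  assumes X: "density (m * n) X"
  shows "mutual_info m n X = ereal (log_tr X X
    - log_tr (marg_fst m n X) (marg_fst m n X) - log_tr (marg_snd m n X) (marg_snd m n X))"
proof -
  note X' = densityD[OF X]
  note M = psd_marg[OF X'(1)]
  show ?thesis
    \<comment> \<open>The kernel condition holds for the state's own marginals, so the finite case
      applies and the logarithm of the product splits into two entropies.\<close>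
    unfolding mutual_info_def rel_entropy_eq[OF X'(1) psd_tensor[OF M]]
    using ker_le_marg_tensor[OF X'(1)] log_tr_tensor[OF X'(1) M ker_le_marg_tensor[OF X'(1)]] by simp
qed

text \<open>Finiteness of the divergence in the joint system passes to the marginal: each diagonal
  entry of the marginal is a sum of joint entries, all zero where \<open>B\<close> vanishes. It
  provides the hypothesis of \<open>rel_entropy_mix_bound\<close>.\<close>

lemma ker_le_marg_snd:
  assumes X: "psd (m * n) X" and A: "psd m A" and B: "psd n B" and le: "ker_le (m * n) (A \<otimes>\<^sub>m B) X"
  shows "ker_le n B (marg_snd m n X)"
proof -
  have cX: "X \<in> carrier_mat (m * n) (m * n)" using X by (auto simp: psd_def)
  obtain U d where U: "spec m A U d" by (rule psdE[OF A]) blast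
  obtain V e where V: "spec n B V e" by (rule psdE[OF B]) blast
  have u: "unitary m U" "unitary n V" using U V by (auto simp: spec_def)
  have "diag_in V (marg_snd m n X) j = 0" if j: "j < n" "e j = 0" for j
  proof -
    have "diag_in V (marg_snd m n X) j = (\<Sum>i<n. diag_in V (marg_snd m n X) i * (if i = j then 1 else 0))"
      using j by (simp add: if_distrib[of "\<lambda>x. _ * x"] sum.delta cong: if_cong)
    also have "\<dots> = (\<Sum>k<m * n. diag_in (U \<otimes>\<^sub>m V) X k * (if k mod n = j then 1 else 0))"
      by (rule diag_in_marg(2)[OF cX u, symmetric])
    also have "\<dots> = 0"
      using le ker_le_iff_diag_in[OF X spec_tensor[OF U V]] j by (intro sum.neutral) auto
    finally show ?thesis .
  qed
  then show ?thesis using ker_le_iff_diag_in[OF psd_marg(2)[OF X] V] by blast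
qed

lemma mutual_info_flag:
  assumes X: "density (r * n) X" and S: "density n S" and p: "0 < p" "p < 1"
    and le: "ker_le (r * n) (marg_fst r n X \<otimes>\<^sub>m S) X"
  shows "mutual_info (r + r) n (flag r n p X S) = ereal
    (p * (log_tr X X - log_tr X (marg_fst r n X \<otimes>\<^sub>m S))
      - (log_tr (mix p (marg_snd r n X) S) (mix p (marg_snd r n X) S) - log_tr (mix p (marg_snd r n X) S) S))"
proof -
  let ?R = "marg_fst r n X" and ?A = "marg_snd r n X" and ?F = "flag r n p X S"
  let ?q = "1 - p"
  note X' = densityD[OF X] and S' = densityD[OF S]
  have R: "density r ?R" and A: "density n ?A" using density_marg[OF X] .
  note R' = densityD[OF R] and A' = densityD[OF A]
  have Y: "density (r * n) (?R \<otimes>\<^sub>m S)" using density_tensor[OF R S] .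
  note Y' = densityD[OF Y]
  have sm: "complex_of_real p \<cdot>\<^sub>m X \<in> carrier_mat (r * n) (r * n)"
    "complex_of_real ?q \<cdot>\<^sub>m (?R \<otimes>\<^sub>m S) \<in> carrier_mat (r * n) (r * n)" using X' Y' by auto
  have marg_smult: "marg_fst r n (c \<cdot>\<^sub>m Z) = c \<cdot>\<^sub>m marg_fst r n Z" "marg_snd r n (c \<cdot>\<^sub>m Z) = c \<cdot>\<^sub>m marg_snd r n Z"
    if "Z \<in> carrier_mat (r * n) (r * n)" for c Z
    using that by (auto intro!: eq_matI simp: marg_fst_def marg_snd_def block_index_less sum_distrib_left)
  have F1: "marg_fst (r + r) n ?F = dsum (complex_of_real p \<cdot>\<^sub>m ?R) (complex_of_real ?q \<cdot>\<^sub>m ?R)"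
    unfolding flag_def marg_dsum(1)[OF sm]
    by (simp add: marg_smult X' Y' marg_tensor(1)[OF R'(2) S'(2)] S'(3) del: of_real_diff)
  have F2: "marg_snd (r + r) n ?F = mix p ?A S"
    unfolding flag_def marg_dsum(2)[OF sm] mix_def
    by (simp add: marg_smult X' Y' marg_tensor(2)[OF R'(2) S'(2)] R'(3) del: of_real_diff)
  have e: "log_tr (dsum (complex_of_real p \<cdot>\<^sub>m P) (complex_of_real ?q \<cdot>\<^sub>m Q)) (dsum (complex_of_real p \<cdot>\<^sub>m P) (complex_of_real ?q \<cdot>\<^sub>m Q))
      = p * log_tr P P + p * ln p + (?q * log_tr Q Q + ?q * ln ?q)" if "density k P" "density k Q" for k P Q
    using p log_tr_self_dsum[OF psd_smult[OF densityD(1)[OF that(1)], of p] psd_smult[OF densityD(1)[OF that(2)], of ?q]]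
      log_tr_self_smult[OF densityD(1)[OF that(1)], of p] log_tr_self_smult[OF densityD(1)[OF that(2)], of ?q]
      densityD(3)[OF that(1)] densityD(3)[OF that(2)]
    by (simp del: of_real_diff)
  have eF: "log_tr ?F ?F = p * log_tr X X + p * ln p + (?q * (log_tr ?R ?R + log_tr S S) + ?q * ln ?q)"
    unfolding flag_def e[OF X Y] log_tr_self_tensor[OF R S] ..
  have eR: "log_tr (dsum (complex_of_real p \<cdot>\<^sub>m ?R) (complex_of_real ?q \<cdot>\<^sub>m ?R)) (dsum (complex_of_real p \<cdot>\<^sub>m ?R) (complex_of_real ?q \<cdot>\<^sub>m ?R))
      = p * log_tr ?R ?R + p * ln p + (?q * log_tr ?R ?R + ?q * ln ?q)"
    by (rule e[OF R R])
  \<comment> \<open>Linearity in the first argument supplies exactly the two terms needed: one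
    completes the divergence of \<open>X\<close>, the other cancels the entropy of \<open>S\<close>
    from the product branch.\<close>
  have m: "log_tr (mix p ?A S) S = p * log_tr ?A S + ?q * log_tr S S"
    unfolding mix_def using A'(2) S'(1,2)
    by (simp add: log_tr_add[of _ n] log_tr_smult[of _ n] del: of_real_diff)
  have x: "log_tr X (?R \<otimes>\<^sub>m S) = log_tr ?R ?R + log_tr ?A S"
    by (rule log_tr_tensor[OF X'(1) R'(1) S'(1) le])
  have dF: "density ((r + r) * n) ?F" using density_flag[OF X S] p by simp
  show ?thesis
    unfolding mutual_info_eq[OF dF] F1 F2 eF eR m x by (simp add: algebra_simps)
qed

text \<open>By \<open>mutual_info_flag\<close> the quotient by \<open>p\<close> is
  \<open>D - g p / p\<close>, squeezed between \<open>D - K * p\<close> and \<open>D\<close>. The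
  real function \<open>f\<close> is introduced so that the limit can be taken outside the extended
  reals.\<close>

lemma mutual_info_flag_tendsto:
  assumes X: "density (r * n) X" and S: "density n S"
    and le: "ker_le (r * n) (marg_fst r n X \<otimes>\<^sub>m S) X"
  shows "\<exists>f. (\<forall>p. 0 < p \<longrightarrow> p < 1 \<longrightarrow> mutual_info (r + r) n (flag r n p X S) = ereal (f p)) \<and>
    ((\<lambda>p. f p / p) \<longlongrightarrow> log_tr X X - log_tr X (marg_fst r n X \<otimes>\<^sub>m S)) (at_right 0)"
proof -
  let ?A = "marg_snd r n X"
  define D where "D = log_tr X X - log_tr X (marg_fst r n X \<otimes>\<^sub>m S)"
  define g where "g p = log_tr (mix p ?A S) (mix p ?A S) - log_tr (mix p ?A S) S" for p
  have "ker_le n S ?A"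
    by (rule ker_le_marg_snd[OF densityD(1)[OF X] densityD(1)[OF density_marg(1)[OF X]] densityD(1)[OF S] le])
  then obtain K where K: "\<And>p. 0 \<le> p \<Longrightarrow> p \<le> 1 \<Longrightarrow> 0 \<le> g p \<and> g p \<le> K * p\<^sup>2"
    using rel_entropy_mix_bound[OF density_marg(2)[OF X] S] unfolding g_def by blast
  have ev: "eventually (\<lambda>p. 0 < p \<and> p < 1) (at_right (0 :: real))"
    by (auto simp: eventually_at_right_field intro!: exI[of _ 1])
  have "((\<lambda>p. (p * D - g p) / p) \<longlongrightarrow> D) (at_right 0)"
  proof (rule tendsto_sandwich[of "\<lambda>p. D - K * p" _ _ "\<lambda>_. D"])
    show "eventually (\<lambda>p. D - K * p \<le> (p * D - g p) / p) (at_right 0)"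
      using ev
    proof eventually_elim
      case (elim p)
      then have "g p \<le> K * p * p" using K[of p] by (simp add: power2_eq_square)
      then have "(D - K * p) * p \<le> p * D - g p" by (simp add: algebra_simps)
      then show ?case using elim by (simp only: pos_le_divide_eq)
    qed
    show "eventually (\<lambda>p. (p * D - g p) / p \<le> D) (at_right 0)"
      using ev
    proof eventually_elim
      case (elim p)
      then show ?case using K[of p] by (simp add: pos_divide_le_eq algebra_simps)
    qed
    have "((\<lambda>p. D - K * p) \<longlongrightarrow> D - K * 0) (at_right 0)" by (intro tendsto_intros)
    then show "((\<lambda>p. D - K * p) \<longlongrightarrow> D) (at_right 0)" by simp
  qed simp
  moreover have "mutual_info (r + r) n (flag r n p X S) = ereal (p * D - g p)" if "0 < p" "p < 1" for p
    unfolding D_def g_def by (rule mutual_info_flag[OF X S that le])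
  ultimately show ?thesis
    unfolding D_def[symmetric] by (intro exI[of _ "\<lambda>p. p * D - g p"]) simp
qed

section \<open>Comparison of the two suprema\<close>

lemma mutual_info_extend:
  assumes N: "channel a b N" and X: "density (c * a) X"
  shows "mutual_info c b (extend c a b N X)
    = rel_entropy (extend c a b N X) (marg_fst c a X \<otimes>\<^sub>m N (marg_snd c a X))"
  using N densityD(2)[OF X] by (simp add: mutual_info_def marg_fst_extend marg_snd_extend channel_def)

lemma rel_entropy_self: "psd n A \<Longrightarrow> rel_entropy A A = 0"
  by (simp add: rel_entropy_eq ker_le_def zero_ereal_def)

text \<open>Nonemptiness is claimed along with the bound because \<open>sup_ratio\<close> assigns 0
  to the empty set, whose supremum in \<open>ereal\<close> is minus infinity.\<close>

lemma prod_ratio_le_Sup_MI_ratios: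
  defines "S \<equiv> \<lambda>a b N. {mutual_info c b (extend c a b N \<rho>) / mutual_info c a \<rho> | c \<rho>.
    c > 0 \<and> density (c * a) \<rho> \<and> 0 < mutual_info c a \<rho> \<and> mutual_info c a \<rho> < \<infinity>}"
  assumes N: "channel a b N" and r: "0 < r" and X: "density (r * a) X" and S: "density a \<sigma>"
    and pos: "0 < rel_entropy X (marg_fst r a X \<otimes>\<^sub>m \<sigma>)" and fin: "rel_entropy X (marg_fst r a X \<otimes>\<^sub>m \<sigma>) < \<infinity>"
  shows "S a b N \<noteq> {}"
    and "rel_entropy (extend r a b N X) (marg_fst r a X \<otimes>\<^sub>m N \<sigma>) / rel_entropy X (marg_fst r a X \<otimes>\<^sub>m \<sigma>)
      \<le> Sup (S a b N)"
proof -
  let ?Y = "marg_fst r a X \<otimes>\<^sub>m \<sigma>" and ?X' = "extend r a b N X"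
  have lin: "linear_map a b N" "trace_preserving a N" using N by (auto simp: channel_def)
  have Y: "density (r * a) ?Y" using density_tensor[OF density_marg(1)[OF X] S] .
  have X': "density (r * b) ?X'" using density_extend[OF N X] .
  have S': "density b (N \<sigma>)" using density_channel[OF N S] .
  have R': "marg_fst r b ?X' = marg_fst r a X" using marg_fst_extend[OF lin densityD(2)[OF X]] .
  have Y': "density (r * b) (marg_fst r a X \<otimes>\<^sub>m N \<sigma>)"
    using density_tensor[OF density_marg(1)[OF X] S'] .
  have le: "ker_le (r * a) ?Y X"
    using fin rel_entropy_eq[OF densityD(1)[OF X] densityD(1)[OF Y]] by (auto split: if_splits)
  have le': "ker_le (r * b) (marg_fst r b ?X' \<otimes>\<^sub>m N \<sigma>) ?X'"
    using ker_le_extend[OF N densityD(1)[OF X] densityD(1)[OF Y] le]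
    by (simp add: extend_tensor[OF lin(1) marg_carrier(1) densityD(2)[OF S]] R')
  define D where "D = log_tr X X - log_tr X ?Y"
  define D' where "D' = log_tr ?X' ?X' - log_tr ?X' (marg_fst r b ?X' \<otimes>\<^sub>m N \<sigma>)"
  have D: "rel_entropy X ?Y = ereal D"
    using rel_entropy_eq[OF densityD(1)[OF X] densityD(1)[OF Y]] le by (simp add: D_def)
  have D': "rel_entropy ?X' (marg_fst r a X \<otimes>\<^sub>m N \<sigma>) = ereal D'"
    using rel_entropy_eq[OF densityD(1)[OF X'] densityD(1)[OF Y']] le' by (simp add: D'_def R')
  have Dpos: "0 < D" using pos D by simp
  obtain f where f: "\<And>p. 0 < p \<Longrightarrow> p < 1 \<Longrightarrow> mutual_info (r + r) a (flag r a p X \<sigma>) = ereal (f p)"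
    and fl: "((\<lambda>p. f p / p) \<longlongrightarrow> D) (at_right 0)"
    using mutual_info_flag_tendsto[OF X S le] unfolding D_def by blast
  obtain f' where f': "\<And>p. 0 < p \<Longrightarrow> p < 1 \<Longrightarrow> mutual_info (r + r) b (flag r b p ?X' (N \<sigma>)) = ereal (f' p)"
    and fl': "((\<lambda>p. f' p / p) \<longlongrightarrow> D') (at_right 0)"
    using mutual_info_flag_tendsto[OF X' S' le'] unfolding D'_def by blast
  have ev: "eventually (\<lambda>p. 0 < p \<and> p < 1) (at_right (0 :: real))"
    by (auto simp: eventually_at_right_field intro!: exI[of _ 1])
  \<comment> \<open>Since the limit \<open>D\<close> is positive, the flag states have positive
    mutual information for small \<open>p\<close> and are admissible in the supremum.\<close>
  have "eventually (\<lambda>p. 0 < f p / p) (at_right 0)" using order_tendstoD(1)[OF fl Dpos] .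
  \<comment> \<open>Dividing numerator and denominator by \<open>p\<close> leaves the ratio
    unchanged but gives both a finite limit, the lower one nonzero.\<close>
  with ev have mem: "eventually (\<lambda>p. 0 < p \<and> ereal ((f' p / p) / (f p / p)) \<in> S a b N) (at_right 0)"
  proof eventually_elim
    case (elim p)
    then have fp: "0 < f p" by (simp add: zero_less_divide_iff)
    have "extend (r + r) a b N (flag r a p X \<sigma>) = flag r b p ?X' (N \<sigma>)"
      by (rule extend_flag[OF N densityD(2)[OF X] densityD(2)[OF S]])
    then have "mutual_info (r + r) b (extend (r + r) a b N (flag r a p X \<sigma>)) / mutual_info (r + r) a (flag r a p X \<sigma>)
        = ereal ((f' p / p) / (f p / p))"
      using f[of p] f'[of p] elim fp by simp
    moreover have "density ((r + r) * a) (flag r a p X \<sigma>)" using density_flag[OF X S, of p] elim by simp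
    ultimately show ?case
      unfolding S_def using r f[of p] elim fp
      by (auto intro!: exI[of _ "r + r"] exI[of _ "flag r a p X \<sigma>"])
  qed
  then show "S a b N \<noteq> {}"
    using eventually_happens[OF mem] by (auto simp: trivial_limit_at_right_real)
  have "((\<lambda>p. ereal ((f' p / p) / (f p / p))) \<longlongrightarrow> ereal (D' / D)) (at_right 0)"
    using Dpos by (intro tendsto_ereal tendsto_divide fl fl') simp
  moreover have "eventually (\<lambda>p. ereal ((f' p / p) / (f p / p)) \<le> Sup (S a b N)) (at_right 0)"
    using mem by eventually_elim (rule Sup_upper, blast)
  ultimately have "ereal (D' / D) \<le> Sup (S a b N)"
    by (rule tendsto_upperbound) (simp add: trivial_limit_at_right_real)
  then show "rel_entropy ?X' (marg_fst r a X \<otimes>\<^sub>m N \<sigma>) / rel_entropy X ?Y \<le> Sup (S a b N)"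
    unfolding D D' using Dpos by simp
qed

text \<open>The premise makes \<open>S\<close> nonempty whenever \<open>T\<close> is, so the default
  value 0 arises on both sides or on neither.\<close>

lemma sup_ratio_eqI:
  assumes sub: "S \<subseteq> T" and le: "\<And>y. y \<in> T \<Longrightarrow> S \<noteq> {} \<and> y \<le> Sup S"
  shows "sup_ratio S = sup_ratio T"
proof (cases "T = {}")
  case False
  then have "S \<noteq> {}" using le by blast
  moreover have "Sup T \<le> Sup S" using le by (intro Sup_least) blast
  ultimately show ?thesis
    using False Sup_subset_mono[OF sub] by (simp add: sup_ratio_def antisym)
qed (use sub in simp)

theorem mainTheorem5:
  fixes a b :: nat and N :: "complex mat \<Rightarrow> complex mat"
  assumes "channel a b N"
  shows "eta_MI a b N = eta_D_prod a b N"
proof -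
  let ?S = "{mutual_info c b (extend c a b N \<rho>) / mutual_info c a \<rho> | c \<rho>.
    c > 0 \<and> density (c * a) \<rho> \<and> 0 < mutual_info c a \<rho> \<and> mutual_info c a \<rho> < \<infinity>}"
  let ?T = "{rel_entropy (extend r a b N \<rho>) (marg_fst r a \<rho> \<otimes>\<^sub>m N \<sigma>)
        / rel_entropy \<rho> (marg_fst r a \<rho> \<otimes>\<^sub>m \<sigma>) | r \<rho> \<sigma>.
        r > 0 \<and> density (r * a) \<rho> \<and> density a \<sigma> \<and>
        \<rho> \<noteq> marg_fst r a \<rho> \<otimes>\<^sub>m \<sigma> \<and>
        0 < rel_entropy \<rho> (marg_fst r a \<rho> \<otimes>\<^sub>m \<sigma>) \<and>
        rel_entropy \<rho> (marg_fst r a \<rho> \<otimes>\<^sub>m \<sigma>) < \<infinity>}"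
  have "?S \<subseteq> ?T"
  proof
    fix x assume "x \<in> ?S"
    then obtain c \<rho> where x: "x = mutual_info c b (extend c a b N \<rho>) / mutual_info c a \<rho>"
      and c: "c > 0" and \<rho>: "density (c * a) \<rho>" and I: "0 < mutual_info c a \<rho>" "mutual_info c a \<rho> < \<infinity>"
      by blast
    \<comment> \<open>Equality would make the mutual information zero, against the positive
      denominator.\<close>
    have "\<rho> \<noteq> marg_fst c a \<rho> \<otimes>\<^sub>m marg_snd c a \<rho>"
      using I(1) rel_entropy_self[OF densityD(1)[OF \<rho>]] unfolding mutual_info_def by auto
    then show "x \<in> ?T"
      using c \<rho> density_marg(2)[OF \<rho>] I unfolding x mutual_info_extend[OF assms \<rho>]
      unfolding mutual_info_def by blast
  qed
  moreover have "?S \<noteq> {} \<and> y \<le> Sup ?S" if "y \<in> ?T" for y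
    using that prod_ratio_le_Sup_MI_ratios[OF assms] by blast
  ultimately show ?thesis
    unfolding eta_MI_def eta_D_prod_def by (rule sup_ratio_eqI)
qed

end
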